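(* Let $n\ge 2$ and let $X=\{x_1,\ldots,x_n\}$ be an $n$-point generic metric space. Put $\delta=\delta(X)/6$ and $N=n(n-1)/2$. Let $U=\{Y\in\mathcal{M}_n : d_{GH}(X,Y)<\delta\}$ be the open ball of radius $\delta$ centered at $X$ in $\mathcal{M}_n$, and let $V=\{v\in\mathbb{R}^N_\infty : \|v-\nu(X)\|_\infty<\delta\}$ be the open ball of radius $\delta$ centered at $\nu(X)$ in $\mathbb{R}^N_\infty$. Then $U\subset\mathcal{M}_{[n]}$ (so that $\nu$ is defined on $U$), and the restriction $\nu|_U\colon U\to V$ is an isometry, i.e., $\nu$ maps $U$ bijectively onto $V$ and $\|\nu(Y)-\nu(Z)\|_\infty=d_{GH}(Y,Z)$ for all $Y,Z\in U$.
   Context: $|xy|$ denotes the distance between points $x,y$ of a metric space. $\mathcal{M}$ is the set of isometry classes of (nonempty) compact metric spaces, endowed with the Gromov--Hausdorff metric $d_{GH}$. $\mathcal{M}_n\subset\mathcal{M}$ consists of all metric spaces having at most $n$ points, and $\mathcal{M}_{[n]}\subset\mathcal{M}_n$ consists of all metric spaces having exactly $n$ points; both carry the restriction of $d_{GH}$. $\mathbb{R}^N_\infty$ is $\mathbb{R}^N$ with the norm $\|(v_1,\ldots,v_N)\|_\infty=\max_i|v_i|$ and the corresponding distance. The mapping $\nu\colon\mathcal{M}_{[n]}\to\mathbb{R}^{n(n-1)/2}_\infty$ is defined as follows: for $Y=\{y_1,\ldots,y_n\}\in\mathcal{M}_{[n]}$, take all $n(n-1)/2$ distances $|y_iy_j|$,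 $i<j$ (with multiplicity), arrange them in ascending order, and let $\nu(Y)$ be the resulting vector divided by $2$. A generic space is a finite metric space in which all non-zero distances (between distinct pairs of points) are pairwise distinct and all triangle inequalities hold strictly, i.e., $|x_ix_j|+|x_jx_k|>|x_ix_k|$ for pairwise distinct $i,j,k$. For an $n$-point metric space $X=\{x_1,\ldots,x_n\}$ with $n\ge3$, $\delta(X)$ is the least of the two numbers $$\min\bigl\{|x_ix_j|+|x_jx_k|-|x_ix_k| : \#\{i,j,k\}=3\bigr\},\qquad \min\Bigl\{\bigl||x_ix_j|-|x_px_q|\bigr| : \#\{i,j,p,q\}\ge3\Bigr\};$$ for $n=2$, $\delta(X)=|x_1x_2|$. *)

theory Defs
  imports "HOL-Analysis.Analysis" "HOL-Library.Multiset"
begin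

definition isometric :: "'a metric \<Rightarrow> 'b metric \<Rightarrow> bool" where
  "isometric X Y \<longleftrightarrow> (\<exists>f. bij_betw f (mspace X) (mspace Y) \<and>
     (\<forall>x\<in>mspace X. \<forall>y\<in>mspace X. mdist Y (f x) (f y) = mdist X x y))"

text \<open>\<open>A\<close> and \<open>B\<close> each lie in the open \<open>r\<close>-neighbourhood of the other.\<close>

definition hausdorff_dist :: "'a metric \<Rightarrow> 'a set \<Rightarrow> 'a set \<Rightarrow> real" where
  "hausdorff_dist Z A B = Inf {r. r > 0 \<and>
     (\<forall>a\<in>A. \<exists>b\<in>B. mdist Z a b < r) \<and> (\<forall>b\<in>B. \<exists>a\<in>A. mdist Z b a < r)}"

text \<open>The infimum is over all realizations of the pair, that is, metric spaces \<open>Z\<close> with subsets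
  \<open>X'\<close> and \<open>Y'\<close> isometric to \<open>X\<close> and \<open>Y\<close>. Points of \<open>Z\<close> outside \<open>X' \<union> Y'\<close> do not affect the
  Hausdorff distance, and \<open>X' \<union> Y'\<close> can be labelled by elements of the sum type, so restricting
  \<open>Z\<close> to that type loses no realization.\<close>

definition gh_dist :: "'a metric \<Rightarrow> 'b metric \<Rightarrow> real" where
  "gh_dist X Y = Inf {hausdorff_dist Z X' Y' | (Z :: ('a + 'b) metric) X' Y'.
     X' \<subseteq> mspace Z \<and> Y' \<subseteq> mspace Z \<and>
     isometric (submetric Z X') X \<and> isometric (submetric Z Y') Y}"

text \<open>A compact metric space has at most continuum many points, so each one is isometric to a
  space whose points are labelled by real numbers. The labels carry no metric information.\<close>

definition isometry_class :: "'a metric \<Rightarrow> real metric set" where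
  "isometry_class X = {Y. isometric X Y}"

definition GH_space :: "real metric set set" where
  "GH_space = {isometry_class X | X :: real metric.
     mspace X \<noteq> {} \<and> compact_space (mtopology_of X)}"

definition GH_atmost :: "nat \<Rightarrow> real metric set set" where
  "GH_atmost n = {A \<in> GH_space. \<forall>Y\<in>A. finite (mspace Y) \<and> card (mspace Y) \<le> n}"

definition GH_exactly :: "nat \<Rightarrow> real metric set set" where
  "GH_exactly n = {A \<in> GH_space. \<forall>Y\<in>A. finite (mspace Y) \<and> card (mspace Y) = n}"

text \<open>The value does not depend on the representatives; see \<open>d_GH_isometry_class\<close> below.\<close>

definition d_GH :: "real metric set \<Rightarrow> real metric set \<Rightarrow> real" where
  "d_GH A B = gh_dist (SOME X. X \<in> A) (SOME Y. Y \<in> B)"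

text \<open>Vectors in \<open>N\<close>-dimensional real space are lists of length \<open>N\<close>; the norm and the distance are used only for
  \<open>N \<ge> 1\<close> and for vectors of equal length.\<close>

definition vec_space :: "nat \<Rightarrow> real list set" where
  "vec_space N = {v. length v = N}"

definition max_norm :: "real list \<Rightarrow> real" where
  "max_norm v = Max {\<bar>v ! i\<bar> | i. i < length v}"

definition max_dist :: "real list \<Rightarrow> real list \<Rightarrow> real" where
  "max_dist v w = max_norm (map2 (-) v w)"

text \<open>The condition \<open>a < b\<close> on the labels selects each unordered pair of distinct points once.\<close>

definition half_distances :: "real metric \<Rightarrow> real list" where
  "half_distances Y = map (\<lambda>t. t / 2) (sorted_list_of_multiset
     (image_mset (\<lambda>(a, b). mdist Y a b)
       (mset_set {(a, b). a \<in> mspace Y \<and> b \<in> mspace Y \<and> a < b})))"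

text \<open>Again independent of the representative; see \<open>nu_isometry_class\<close> below.\<close>

definition nu :: "real metric set \<Rightarrow> real list" where
  "nu A = half_distances (SOME Y. Y \<in> A)"

definition generic_space :: "'a metric \<Rightarrow> bool" where
  "generic_space X \<longleftrightarrow> finite (mspace X) \<and>
     (\<forall>x\<in>mspace X. \<forall>y\<in>mspace X. \<forall>p\<in>mspace X. \<forall>q\<in>mspace X.
        x \<noteq> y \<and> p \<noteq> q \<and> {x, y} \<noteq> {p, q} \<longrightarrow> mdist X x y \<noteq> mdist X p q) \<and>
     (\<forall>x\<in>mspace X. \<forall>y\<in>mspace X. \<forall>z\<in>mspace X.
        x \<noteq> y \<and> y \<noteq> z \<and> x \<noteq> z \<longrightarrow> mdist X x y + mdist X y z > mdist X x z)"

text \<open>In the second minimum one of the two pairs may be degenerate, so that it also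
  bounds the distances between distinct points from below.\<close>

definition delta :: "'a metric \<Rightarrow> real" where
  "delta X =
     (if card (mspace X) = 2
      then THE t. \<exists>x y. mspace X = {x, y} \<and> x \<noteq> y \<and> t = mdist X x y
      else min
        (Min {mdist X x y + mdist X y z - mdist X x z | x y z.
           x \<in> mspace X \<and> y \<in> mspace X \<and> z \<in> mspace X \<and> card {x, y, z} = 3})
        (Min {\<bar>mdist X x y - mdist X p q\<bar> | x y p q.
           x \<in> mspace X \<and> y \<in> mspace X \<and> p \<in> mspace X \<and> q \<in> mspace X \<and>
           card {x, y, p, q} \<ge> 3}))"

lemma isometric_refl: "isometric X X"
  unfolding isometric_def by (rule exI[of _ id]) auto

lemma isometric_sym:
  assumes "isometric X Y" shows "isometric Y X"
proof -
  obtain f where f: "bij_betw f (mspace X) (mspace Y)"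
    and d: "\<And>x y. x \<in> mspace X \<Longrightarrow> y \<in> mspace X \<Longrightarrow> mdist Y (f x) (f y) = mdist X x y"
    using assms unfolding isometric_def by blast
  let ?g = "inv_into (mspace X) f"
  have g: "bij_betw ?g (mspace Y) (mspace X)" using f by (rule bij_betw_inv_into)
  have "mdist X (?g x) (?g y) = mdist Y x y" if "x \<in> mspace Y" "y \<in> mspace Y" for x y
    using d[of "?g x" "?g y"] that bij_betw_apply[OF g] bij_betw_inv_into_right[OF f] by simp
  then show ?thesis using g unfolding isometric_def by blast
qed

lemma isometric_trans:
  assumes "isometric X Y" "isometric Y Z" shows "isometric X Z"
proof -
  obtain f where f: "bij_betw f (mspace X) (mspace Y)"
    and df: "\<And>x y. x \<in> mspace X \<Longrightarrow> y \<in> mspace X \<Longrightarrow> mdist Y (f x) (f y) = mdist X x y"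
    using assms(1) unfolding isometric_def by blast
  obtain g where g: "bij_betw g (mspace Y) (mspace Z)"
    and dg: "\<And>x y. x \<in> mspace Y \<Longrightarrow> y \<in> mspace Y \<Longrightarrow> mdist Z (g x) (g y) = mdist Y x y"
    using assms(2) unfolding isometric_def by blast
  have "bij_betw (g \<circ> f) (mspace X) (mspace Z)" using f g by (rule bij_betw_trans)
  moreover have "mdist Z ((g \<circ> f) x) ((g \<circ> f) y) = mdist X x y"
    if "x \<in> mspace X" "y \<in> mspace X" for x y
    using that df dg f by (simp add: bij_betw_apply)
  ultimately show ?thesis unfolding isometric_def by blast
qed

lemma gh_dist_cong:
  fixes X X' :: "'a metric" and Y Y' :: "'b metric"
  assumes "isometric X X'" "isometric Y Y'"
  shows "gh_dist X Y = gh_dist X' Y'"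
proof -
  have "isometric W X \<longleftrightarrow> isometric W X'" for W :: "('a + 'b) metric"
    using assms(1) isometric_sym isometric_trans by blast
  moreover have "isometric W Y \<longleftrightarrow> isometric W Y'" for W :: "('a + 'b) metric"
    using assms(2) isometric_sym isometric_trans by blast
  ultimately show ?thesis unfolding gh_dist_def by simp
qed

lemma some_isometry_class:
  assumes "isometry_class X \<noteq> {}"
  shows "isometric X (SOME Y. Y \<in> isometry_class X)"
  using some_in_eq[of "isometry_class X"] assms unfolding isometry_class_def by simp

lemma d_GH_isometry_class:
  fixes X Y :: "real metric"
  shows "d_GH (isometry_class X) (isometry_class Y) = gh_dist X Y"
proof -
  have ne: "isometry_class W \<noteq> {}" for W :: "real metric"
    using isometric_refl[of W] by (auto simp: isometry_class_def)
  show ?thesis unfolding d_GH_def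
    by (rule gh_dist_cong[symmetric]) (rule some_isometry_class[OF ne])+
qed

lemma half_distances_cong:
  assumes iso: "isometric X Y" and fin: "finite (mspace X)"
  shows "half_distances X = half_distances Y"
proof -
  obtain f where f: "bij_betw f (mspace X) (mspace Y)"
    and d: "\<And>x y. x \<in> mspace X \<Longrightarrow> y \<in> mspace X \<Longrightarrow> mdist Y (f x) (f y) = mdist X x y"
    using iso unfolding isometric_def by blast
  define P where "P W = {(a, b). a \<in> mspace W \<and> b \<in> mspace W \<and> a < b}" for W :: "real metric"
  define h where "h = (\<lambda>(a, b). (min (f a) (f b), max (f a) (f b)))"
  have inj: "f a = f b \<longleftrightarrow> a = b" if "a \<in> mspace X" "b \<in> mspace X" for a b
    using f that by (auto simp: bij_betw_def inj_on_def)
  have inY: "f a \<in> mspace Y" if "a \<in> mspace X" for a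
    using f that by (rule bij_betw_apply)
  have "inj_on h (P X)"
  proof (rule inj_onI, clarify)
    fix a b a' b'
    assume *: "(a, b) \<in> P X" "(a', b') \<in> P X" "h (a, b) = h (a', b')"
    then have "{f a, f b} = {f a', f b'}"
      by (auto simp: h_def min_def max_def split: if_splits)
    moreover have "a \<in> mspace X" "b \<in> mspace X" "a' \<in> mspace X" "b' \<in> mspace X"
      using * by (auto simp: P_def)
    ultimately have "{a, b} = {a', b'}" unfolding doubleton_eq_iff by (simp add: inj)
    then show "a = a' \<and> b = b'" using * by (auto simp: P_def doubleton_eq_iff)
  qed
  moreover have "h ` P X = P Y"
  proof
    show "h ` P X \<subseteq> P Y"
    proof
      fix p assume "p \<in> h ` P X"
      then obtain a b where *: "p = h (a, b)" "(a, b) \<in> P X" by auto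
      then have ab: "a \<in> mspace X" "b \<in> mspace X" "f a \<noteq> f b"
        using inj[of a b] by (auto simp: P_def)
      show "p \<in> P Y"
        using * ab(3) inY[OF ab(1)] inY[OF ab(2)]
        by (cases "f a < f b") (auto simp: P_def h_def min_def max_def)
    qed
    show "P Y \<subseteq> h ` P X"
    proof clarify
      fix u v assume uv: "(u, v) \<in> P Y"
      then obtain a b where ab: "a \<in> mspace X" "b \<in> mspace X" "u = f a" "v = f b"
        using f unfolding P_def bij_betw_def by blast
      have "a \<noteq> b" using ab uv by (auto simp: P_def)
      then consider "a < b" | "b < a" by linarith
      then show "(u, v) \<in> h ` P X"
      proof cases
        case 1
        then have "(a, b) \<in> P X" "h (a, b) = (u, v)" using ab uv by (auto simp: P_def h_def)
        then show ?thesis by force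
      next
        case 2
        then have "(b, a) \<in> P X" "h (b, a) = (u, v)" using ab uv by (auto simp: P_def h_def)
        then show ?thesis by force
      qed
    qed
  qed
  moreover have "finite (P X)"
    by (rule finite_subset[of _ "mspace X \<times> mspace X"]) (use fin in \<open>auto simp: P_def\<close>)
  ultimately have im: "image_mset h (mset_set (P X)) = mset_set (P Y)"
    by (simp add: image_mset_mset_set)
  have "image_mset (\<lambda>(a, b). mdist Y a b) (mset_set (P Y)) =
      image_mset ((\<lambda>(a, b). mdist Y a b) \<circ> h) (mset_set (P X))"
    unfolding im[symmetric] by (rule multiset.map_comp)
  also have "\<dots> = image_mset (\<lambda>(a, b). mdist X a b) (mset_set (P X))"
  proof (rule image_mset_cong)
    fix p assume "p \<in># mset_set (P X)"
    then obtain a b where p: "p = (a, b)" and ab: "a \<in> mspace X" "b \<in> mspace X"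
      using \<open>finite (P X)\<close> by (auto simp: P_def)
    show "((\<lambda>(a, b). mdist Y a b) \<circ> h) p = (case p of (a, b) \<Rightarrow> mdist X a b)"
      using d[OF ab] mdist_commute[of Y "f b" "f a"] by (simp add: p h_def min_def max_def)
  qed
  finally show ?thesis unfolding half_distances_def P_def by simp
qed

lemma nu_isometry_class:
  assumes "finite (mspace X)"
  shows "nu (isometry_class X) = half_distances X"
proof -
  have "isometry_class X \<noteq> {}"
    using isometric_refl[of X] by (auto simp: isometry_class_def)
  then show ?thesis unfolding nu_def
    using half_distances_cong[OF some_isometry_class assms] by simp
qed

lemma isometry_class_eq:
  assumes "isometric X Y" shows "isometry_class X = isometry_class Y"
  unfolding isometry_class_def
  using isometric_trans[OF assms] isometric_trans[OF isometric_sym[OF assms]] by auto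

lemma finite_isometry_class:
  assumes fin: "finite (mspace X)" and ne: "mspace X \<noteq> {}"
  shows "isometry_class X \<in> GH_exactly (card (mspace X))"
proof -
  obtain g where g: "bij_betw g (mspace X) (real ` {..<card (mspace X)})"
    using finite_same_card_bij[OF fin, of "real ` {..<card (mspace X)}"]
    by (auto simp: card_image)
  define h where "h = inv_into (mspace X) g"
  define S where "S = g ` mspace X"
  have h: "h (g x) = x" if "x \<in> mspace X" for x
    using g that unfolding h_def by (rule bij_betw_inv_into_left)
  interpret M: Metric_space S "\<lambda>x y. mdist X (h x) (h y)"
  proof
    show "mdist X (h x) (h y) = 0 \<longleftrightarrow> x = y" if "x \<in> S" "y \<in> S" for x y
      using that h by (auto simp: S_def)
    show "mdist X (h x) (h z) \<le> mdist X (h x) (h y) + mdist X (h y) (h z)"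
      if "x \<in> S" "y \<in> S" "z \<in> S" for x y z
      using that h by (auto simp: S_def mdist_triangle)
  qed (simp_all add: mdist_commute)
  define Y where "Y = metric (S, \<lambda>x y. mdist X (h x) (h y))"
  have mY: "mspace Y = S" "mdist Y = (\<lambda>x y. mdist X (h x) (h y))"
    unfolding Y_def by simp_all
  have iso: "isometric X Y"
    unfolding isometric_def mY using g h by (intro exI[of _ g]) (auto simp: S_def bij_betw_def)
  have "compact_space (mtopology_of Y)"
    using fin unfolding compact_space_def
    by (intro finite_imp_compactin) (auto simp: mY S_def)
  then have "isometry_class X \<in> GH_space"
    unfolding GH_space_def isometry_class_eq[OF iso] using ne by (auto simp: mY S_def)
  moreover have "finite (mspace Z) \<and> card (mspace Z) = card (mspace X)"
    if "isometric X Z" for Z :: "real metric"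
    using that fin unfolding isometric_def by (auto dest: bij_betw_finite bij_betw_same_card)
  ultimately show ?thesis
    unfolding GH_exactly_def by (auto simp: isometry_class_def)
qed

end

(* The distances in X and their differences are at least 6*delta, and a space at Gromov-Hausdorff
   distance less than delta from X admits a correspondence with X of distortion less than 2*delta.
   Such a correspondence is a bijection and preserves the order of the distances, so a space in the
   ball is a perturbation D of the distance matrix of X, and nu lists the entries D i j / 2 in one
   fixed order of the pairs. Conversely, the slack in the triangle inequalities makes every such
   perturbation a metric.
   For two spaces in the ball the bijection respecting the labels has distortion twice the maximum
   distance of the nu vectors. A better correspondence would be another bijection of the labels, but
   matching two families of reals in increasing order minimizes the largest displacement. *)

theory Submission
  imports Defs
begin

section \<open>Correspondences and the Gromov--Hausdorff distance\<close>

definition correspondence :: "'a metric \<Rightarrow> 'b metric \<Rightarrow> ('a \<times> 'b) set \<Rightarrow> bool" where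
  "correspondence X Y R \<longleftrightarrow> fst ` R = mspace X \<and> snd ` R = mspace Y"

text \<open>A strict bound in place of a supremum: it makes sense for every relation
  \<open>R\<close> and fits statements of the form \<open>gh_dist X Y < r\<close>.\<close>

definition distortion_less :: "'a metric \<Rightarrow> 'b metric \<Rightarrow> ('a \<times> 'b) set \<Rightarrow> real \<Rightarrow> bool" where
  "distortion_less X Y R t \<longleftrightarrow> (\<forall>(a, b)\<in>R. \<forall>(a', b')\<in>R. \<bar>mdist X a a' - mdist Y b b'\<bar> < t)"

definition hausdorff_radii :: "'a metric \<Rightarrow> 'a set \<Rightarrow> 'a set \<Rightarrow> real set" where
  "hausdorff_radii Z A B = {r. r > 0 \<and>
     (\<forall>a\<in>A. \<exists>b\<in>B. mdist Z a b < r) \<and> (\<forall>b\<in>B. \<exists>a\<in>A. mdist Z b a < r)}"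

text \<open>The index set of the infimum in \<open>gh_dist\<close> gets a name because it has to be
  shown nonempty before the infimum says anything.\<close>

definition realizations ::
  "'a metric \<Rightarrow> 'b metric \<Rightarrow> (('a + 'b) metric \<times> ('a + 'b) set \<times> ('a + 'b) set) set" where
  "realizations X Y = {(Z, X', Y'). X' \<subseteq> mspace Z \<and> Y' \<subseteq> mspace Z \<and>
     isometric (submetric Z X') X \<and> isometric (submetric Z Y') Y}"

lemma hausdorff_dist_eq: "hausdorff_dist Z A B = Inf (hausdorff_radii Z A B)"
  unfolding hausdorff_dist_def hausdorff_radii_def ..

lemma gh_dist_eq: "gh_dist X Y = Inf ((\<lambda>(Z, X', Y'). hausdorff_dist Z X' Y') ` realizations X Y)"
  unfolding gh_dist_def realizations_def by (rule arg_cong[where f = Inf]) (auto simp: image_iff, blast)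

text \<open>The largest cross distance plus one is a radius: the added one gives both positivity and
  the strict inequalities. Without a radius, the real infimum in \<open>hausdorff_dist\<close> would
  be unspecified.\<close>

lemma hausdorff_radii_nonempty:
  assumes "finite A" "finite B" "A \<noteq> {}" "B \<noteq> {}"
  shows "hausdorff_radii Z A B \<noteq> {}"
proof -
  define S where "S = (\<lambda>(a, b). mdist Z a b) ` (A \<times> B)"
  have S: "finite S" "S \<noteq> {}" unfolding S_def using assms by auto
  have le: "mdist Z a b < Max S + 1" if "a \<in> A" "b \<in> B" for a b
  proof -
    have "mdist Z a b \<in> S" unfolding S_def using that by force
    with S show ?thesis using Max_ge[of S "mdist Z a b"] by linarith
  qed
  obtain a b where ab: "a \<in> A" "b \<in> B" using assms by blast
  have "0 < Max S + 1" using le[OF ab] mdist_nonneg[of Z a b] by linarith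
  moreover have "\<forall>a\<in>A. \<exists>b\<in>B. mdist Z a b < Max S + 1" using ab le by blast
  moreover have "\<forall>b\<in>B. \<exists>a\<in>A. mdist Z b a < Max S + 1" using ab le by (subst mdist_commute) blast
  ultimately have "Max S + 1 \<in> hausdorff_radii Z A B" by (simp add: hausdorff_radii_def)
  then show ?thesis by blast
qed

lemma hausdorff_dist_le:
  assumes "r \<in> hausdorff_radii Z A B" shows "hausdorff_dist Z A B \<le> r"
  unfolding hausdorff_dist_eq using assms
  by (intro cInf_lower bdd_belowI[of _ 0]) (auto simp: hausdorff_radii_def)

lemma hausdorff_dist_nonneg:
  assumes "finite A" "finite B" "A \<noteq> {}" "B \<noteq> {}"
  shows "0 \<le> hausdorff_dist Z A B"
  unfolding hausdorff_dist_eq using hausdorff_radii_nonempty[OF assms]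
  by (intro cInf_greatest) (auto simp: hausdorff_radii_def)

lemma isometric_submetric_finite:
  assumes "isometric (submetric Z A) X" "A \<subseteq> mspace Z" "finite (mspace X)" "mspace X \<noteq> {}"
  shows "finite A" "A \<noteq> {}"
proof -
  have "mspace (submetric Z A) = A" using assms(2) by auto
  then obtain f where f: "bij_betw f A (mspace X)" using assms(1) unfolding isometric_def by metis
  then show "finite A" using assms(3) bij_betw_finite by blast
  show "A \<noteq> {}" using f assms(4) by (auto simp: bij_betw_def)
qed

text \<open>In the glued metric the distance from \<open>x\<close> to \<open>y\<close> is the length of a shortest path through a
  bridge of length \<open>c\<close> joining a pair of the correspondence.\<close>

lemma glued_realization:
  fixes X :: "'a metric" and Y :: "'b metric"
  assumes fin: "finite (mspace X)" "finite (mspace Y)" and ne: "mspace X \<noteq> {}"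
    and R: "correspondence X Y R" and c: "c > 0" "distortion_less X Y R (2 * c)"
  shows "\<exists>Z X' Y'. (Z, X', Y') \<in> realizations X Y \<and> hausdorff_dist Z X' Y' \<le> c"
proof -
  have Rsub: "R \<subseteq> mspace X \<times> mspace Y" using R unfolding correspondence_def by force
  have finR: "finite R" using Rsub fin by (meson finite_SigmaI finite_subset)
  have neR: "R \<noteq> {}" using R ne unfolding correspondence_def by auto
  define t where "t x y = (\<lambda>(a, b). mdist X x a + (c + mdist Y b y))" for x y
  define k where "k x y = Min (t x y ` R)" for x y
  have k_le: "k x y \<le> mdist X x a + (c + mdist Y b y)" if "(a, b) \<in> R" for x y a b
    unfolding k_def using that finR by (intro Min_le) (force simp: t_def)+
  have k_ex: "\<exists>a b. (a, b) \<in> R \<and> k x y = mdist X x a + (c + mdist Y b y)" for x y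
  proof -
    have "k x y \<in> t x y ` R" unfolding k_def using finR neR by (intro Min_in) auto
    then show ?thesis by (auto simp: t_def)
  qed
  \<comment> \<open>Every crossing uses a bridge of length \<open>c\<close>, so points of different
    parts stay at positive distance.\<close>
  have k_ge: "c \<le> k x y" for x y
    using k_ex[of x y] by (metis add_increasing add.commute add_increasing2 mdist_nonneg order_refl)
  define d where "d p q = (case (p, q) of (Inl x, Inl x') \<Rightarrow> mdist X x x' | (Inr y, Inr y') \<Rightarrow> mdist Y y y'
     | (Inl x, Inr y) \<Rightarrow> k x y | (Inr y, Inl x) \<Rightarrow> k x y)" for p q
  have d_simps [simp]: "d (Inl x) (Inl x') = mdist X x x'" "d (Inr y) (Inr y') = mdist Y y y'"
     "d (Inl x) (Inr y) = k x y" "d (Inr y) (Inl x) = k x y" for x y x' y'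
    by (simp_all add: d_def)
  have triX: "mdist X x z \<le> mdist X x y + mdist X y z"
    if "x \<in> mspace X" "y \<in> mspace X" "z \<in> mspace X" for x y z
    using that by (rule mdist_triangle)
  have triY: "mdist Y x z \<le> mdist Y x y + mdist Y y z"
    if "x \<in> mspace Y" "y \<in> mspace Y" "z \<in> mspace Y" for x y z
    using that by (rule mdist_triangle)
  have dist: "\<bar>mdist X a a' - mdist Y b b'\<bar> < 2 * c" if "(a, b) \<in> R" "(a', b') \<in> R" for a b a' b'
    using c(2) that unfolding distortion_less_def by blast
  \<comment> \<open>The best bridge for \<open>x'\<close> and \<open>y\<close> is also a candidate
    for \<open>x\<close> and \<open>y\<close>. The next fact is the same argument on the other
    side.\<close>
  have LLR: "k x y \<le> mdist X x x' + k x' y" if "x \<in> mspace X" "x' \<in> mspace X" for x x' y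
  proof -
    obtain a b where ab: "(a, b) \<in> R" "k x' y = mdist X x' a + (c + mdist Y b y)" using k_ex by blast
    then have "a \<in> mspace X" using Rsub by blast
    from triX[OF that this] k_le[OF ab(1), of x y] ab(2) show ?thesis by linarith
  qed
  have LRR: "k x y \<le> k x y' + mdist Y y' y" if "y \<in> mspace Y" "y' \<in> mspace Y" for x y y'
  proof -
    obtain a b where ab: "(a, b) \<in> R" "k x y' = mdist X x a + (c + mdist Y b y')" using k_ex by blast
    then have "b \<in> mspace Y" using Rsub by blast
    from triY[OF this that(2,1)] k_le[OF ab(1), of x y] ab(2) show ?thesis by linarith
  qed
  \<comment> \<open>Going from \<open>x\<close> to \<open>x'\<close> through \<open>y\<close>
    crosses two bridges. Replacing the piece between \<open>b\<close> and \<open>b'\<close> by the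
    one between \<open>a\<close> and \<open>a'\<close> costs less than \<open>2 * c\<close>, which
    the two bridges pay for.\<close>
  have LRL: "mdist X x x' \<le> k x y + k x' y"
    if "x \<in> mspace X" "x' \<in> mspace X" "y \<in> mspace Y" for x x' y
  proof -
    obtain a b where ab: "(a, b) \<in> R" "k x y = mdist X x a + (c + mdist Y b y)" using k_ex by blast
    obtain a' b' where ab': "(a', b') \<in> R" "k x' y = mdist X x' a' + (c + mdist Y b' y)"
      using k_ex by blast
    have m: "a \<in> mspace X" "b \<in> mspace Y" "a' \<in> mspace X" "b' \<in> mspace Y" using ab ab' Rsub by auto
    show ?thesis using triX[OF that(1) m(1) that(2)] triX[OF m(1) m(3) that(2)]
      triY[OF m(2) that(3) m(4)] dist[OF ab(1) ab'(1)] ab(2) ab'(2)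
      mdist_commute[of X x' a'] mdist_commute[of Y b' y] by linarith
  qed
  have RLR: "mdist Y y y' \<le> k x y + k x y'"
    if "x \<in> mspace X" "y \<in> mspace Y" "y' \<in> mspace Y" for x y y'
  proof -
    obtain a b where ab: "(a, b) \<in> R" "k x y = mdist X x a + (c + mdist Y b y)" using k_ex by blast
    obtain a' b' where ab': "(a', b') \<in> R" "k x y' = mdist X x a' + (c + mdist Y b' y')"
      using k_ex by blast
    have m: "a \<in> mspace X" "b \<in> mspace Y" "a' \<in> mspace X" "b' \<in> mspace Y" using ab ab' Rsub by auto
    show ?thesis using triY[OF that(2) m(2) that(3)] triY[OF m(2) m(4) that(3)]
      triX[OF m(1) that(1) m(3)] dist[OF ab(1) ab'(1)] ab(2) ab'(2)
      mdist_commute[of X x a] mdist_commute[of Y y b] by linarith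
  qed
  define S where "S = Inl ` mspace X \<union> Inr ` mspace Y"
  have "Metric_space S d"
  proof
    \<comment> \<open>\<open>Metric_space\<close> asks for nonnegativity and symmetry for all
      arguments, not only on the carrier.\<close>
    show "0 \<le> d p q" for p q
      using k_ge c(1) by (cases p; cases q) (auto intro: order_trans[of 0 c])
    show "d p q = d q p" for p q
      by (cases p; cases q) (auto simp: mdist_commute)
    show "d p q = 0 \<longleftrightarrow> p = q" if "p \<in> S" "q \<in> S" for p q
    proof -
      have "k x y \<noteq> 0" for x y using k_ge[of x y] c(1) by linarith
      then show ?thesis using that by (auto simp: S_def)
    qed
    show "d p r \<le> d p q + d q r" if "p \<in> S" "q \<in> S" "r \<in> S" for p q r
      using that unfolding S_def
    proof (elim UnE imageE; hypsubst)
      show "d (Inl x) (Inr y) \<le> d (Inl x) (Inr y') + d (Inr y') (Inr y)"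
        if "y \<in> mspace Y" "y' \<in> mspace Y" for x y y' using LRR that by simp
      show "d (Inr y) (Inl x) \<le> d (Inr y) (Inl x') + d (Inl x') (Inl x)"
        if "x \<in> mspace X" "x' \<in> mspace X" for x x' y
        using LLR[OF that, of y] mdist_commute[of X x x'] by simp
      show "d (Inr y) (Inl x) \<le> d (Inr y) (Inr y') + d (Inr y') (Inl x)"
        if "y \<in> mspace Y" "y' \<in> mspace Y" for x y y'
        using LRR[OF that, of x] mdist_commute[of Y y y'] by simp
    qed (simp_all add: triX triY LLR LRL RLR)
  qed
  then obtain Z where mZ: "mspace Z = S" "mdist Z = d"
    using Metric_space.mspace_metric Metric_space.mdist_metric by blast
  let ?X' = "Inl ` mspace X" and ?Y' = "Inr ` mspace Y"
  have "isometric (submetric Z ?X') X" unfolding isometric_def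
    by (rule exI[of _ projl]) (auto simp: mZ S_def mdist_submetric bij_betw_def inj_on_def image_iff)
  moreover have "isometric (submetric Z ?Y') Y" unfolding isometric_def
    by (rule exI[of _ projr]) (auto simp: mZ S_def mdist_submetric bij_betw_def inj_on_def image_iff)
  ultimately have real: "(Z, ?X', ?Y') \<in> realizations X Y"
    unfolding realizations_def by (auto simp: mZ S_def)
  have kc: "k a b \<le> c" if "(a, b) \<in> R" for a b
  proof -
    have "a \<in> mspace X" "b \<in> mspace Y" using that Rsub by auto
    then show ?thesis using k_le[OF that, of a b] mdist_zero[of a X a] mdist_zero[of b Y b] by (metis add_0 add.right_neutral)
  qed
  have "hausdorff_dist Z ?X' ?Y' \<le> c"
  \<comment> \<open>Corresponding points are only known to be at distance at most \<open>c\<close>,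
    whereas radii need strict inequalities, so \<open>c + e\<close> serves as radius.\<close>
  proof (rule field_le_epsilon)
    fix e :: real assume "e > 0"
    have "\<exists>y\<in>mspace Y. k x y < c + e" if "x \<in> mspace X" for x
    proof -
      have "x \<in> fst ` R" using that R by (simp add: correspondence_def)
      then obtain y where "(x, y) \<in> R" by auto
      then show ?thesis using kc \<open>e > 0\<close> Rsub by (intro bexI[of _ y]) fastforce+
    qed
    moreover have "\<exists>x\<in>mspace X. k x y < c + e" if "y \<in> mspace Y" for y
    proof -
      have "y \<in> snd ` R" using that R by (simp add: correspondence_def)
      then obtain x where "(x, y) \<in> R" by auto
      then show ?thesis using kc \<open>e > 0\<close> Rsub by (intro bexI[of _ x]) fastforce+
    qed
    ultimately show "hausdorff_dist Z ?X' ?Y' \<le> c + e"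
      using c(1) \<open>e > 0\<close> by (intro hausdorff_dist_le) (auto simp: hausdorff_radii_def mZ)
  qed
  with real show ?thesis by blast
qed

text \<open>The full product is a correspondence, and its distortion is bounded because both spaces
  are finite, so gluing produces a realization.\<close>

lemma realizations_nonempty:
  fixes X :: "'a metric" and Y :: "'b metric"
  assumes fin: "finite (mspace X)" "finite (mspace Y)" and ne: "mspace X \<noteq> {}" "mspace Y \<noteq> {}"
  shows "realizations X Y \<noteq> {}"
proof -
  let ?R = "mspace X \<times> mspace Y"
  define D where "D = (\<lambda>(p, q). \<bar>mdist X (fst p) (fst q) - mdist Y (snd p) (snd q)\<bar>)"
  define T where "T = D ` (?R \<times> ?R)"
  define B where "B = \<bar>Max T\<bar> + 1"
  have B: "0 < B" "Max T < 2 * B" unfolding B_def by (auto simp: abs_if)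
  have T: "D (p, q) < 2 * B" if "p \<in> ?R" "q \<in> ?R" for p q
  proof -
    have "D (p, q) \<in> T" unfolding T_def using that by blast
    moreover have "finite T" unfolding T_def using fin by blast
    ultimately have "D (p, q) \<le> Max T" by (rule Max_ge[rotated])
    then show ?thesis using B(2) by (rule le_less_trans)
  qed
  have "distortion_less X Y ?R (2 * B)"
    unfolding distortion_less_def using T unfolding D_def by fastforce
  moreover have "correspondence X Y ?R" using ne by (auto simp: correspondence_def)
  ultimately show ?thesis
    using glued_realization[OF fin ne(1), of ?R B] B(1) by fastforce
qed

text \<open>The strict form of the formula that the Gromov-Hausdorff distance is half the least
  distortion of a correspondence. A realization gives the correspondence of nearby points; a
  correspondence gives a realization by gluing.\<close>

lemma gh_dist_less_iff:
  fixes X :: "'a metric" and Y :: "'b metric"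
  assumes fin: "finite (mspace X)" "finite (mspace Y)" and ne: "mspace X \<noteq> {}" "mspace Y \<noteq> {}"
  shows "gh_dist X Y < r \<longleftrightarrow> (\<exists>R. correspondence X Y R \<and> distortion_less X Y R (2 * r))"
proof
  assume "gh_dist X Y < r"
  then obtain Z X' Y' where real: "(Z, X', Y') \<in> realizations X Y" "hausdorff_dist Z X' Y' < r"
    unfolding gh_dist_eq using cInf_lessD[of "_ ` realizations X Y" r] realizations_nonempty[OF assms]
    by (fastforce)
  then have sub: "X' \<subseteq> mspace Z" "Y' \<subseteq> mspace Z"
    and iso: "isometric (submetric Z X') X" "isometric (submetric Z Y') Y"
    by (auto simp: realizations_def)
  have "hausdorff_radii Z X' Y' \<noteq> {}"
    using isometric_submetric_finite[OF iso(1) sub(1) fin(1) ne(1)]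
      isometric_submetric_finite[OF iso(2) sub(2) fin(2) ne(2)] by (intro hausdorff_radii_nonempty)
  then obtain s where s: "s \<in> hausdorff_radii Z X' Y'" "s < r"
    using real(2) cInf_lessD unfolding hausdorff_dist_eq by blast
  have ms: "mspace (submetric Z X') = X'" "mspace (submetric Z Y') = Y'" using sub by auto
  obtain f where f: "bij_betw f X' (mspace X)"
    and df: "\<And>x y. x \<in> X' \<Longrightarrow> y \<in> X' \<Longrightarrow> mdist X (f x) (f y) = mdist Z x y"
    using iso(1) unfolding isometric_def ms by (auto simp: mdist_submetric)
  obtain g where g: "bij_betw g Y' (mspace Y)"
    and dg: "\<And>x y. x \<in> Y' \<Longrightarrow> y \<in> Y' \<Longrightarrow> mdist Y (g x) (g y) = mdist Z x y"
    using iso(2) unfolding isometric_def ms by (auto simp: mdist_submetric)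
  \<comment> \<open>Since \<open>s\<close> is a Hausdorff radius, every point has a partner closer
    than \<open>s\<close>. Two such pairs change a distance by less than
    \<open>2 * s\<close>.\<close>
  define R where "R = {(f x, g y) | x y. x \<in> X' \<and> y \<in> Y' \<and> mdist Z x y < s}"
  have "fst ` R = f ` X'"
  proof
    show "f ` X' \<subseteq> fst ` R"
    proof clarify
      fix x assume "x \<in> X'"
      with s(1) obtain y where "y \<in> Y'" "mdist Z x y < s" unfolding hausdorff_radii_def by blast
      with \<open>x \<in> X'\<close> have "(f x, g y) \<in> R" unfolding R_def by blast
      then show "f x \<in> fst ` R" by force
    qed
  qed (auto simp: R_def)
  moreover have "snd ` R = g ` Y'"
  proof
    show "g ` Y' \<subseteq> snd ` R"
    proof clarify
      fix y assume "y \<in> Y'"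
      with s(1) obtain x where "x \<in> X'" "mdist Z y x < s" unfolding hausdorff_radii_def by blast
      with \<open>y \<in> Y'\<close> have "(f x, g y) \<in> R" unfolding R_def by (subst (asm) mdist_commute) blast
      then show "g y \<in> snd ` R" by force
    qed
  qed (auto simp: R_def)
  ultimately have "correspondence X Y R"
    using f g by (simp add: correspondence_def bij_betw_def)
  moreover have "distortion_less X Y R (2 * r)"
    unfolding distortion_less_def
  proof (clarify, goal_cases)
    case (1 a b a' b')
    from 1(1) obtain x y where xy: "a = f x" "b = g y" "x \<in> X'" "y \<in> Y'" "mdist Z x y < s"
      by (auto simp: R_def)
    from 1(2) obtain x' y' where xy': "a' = f x'" "b' = g y'" "x' \<in> X'" "y' \<in> Y'" "mdist Z x' y' < s"
      by (auto simp: R_def)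
    have m: "x \<in> mspace Z" "y \<in> mspace Z" "x' \<in> mspace Z" "y' \<in> mspace Z" using xy xy' sub by auto
    have "mdist Z x x' \<le> mdist Z x y + mdist Z y y' + mdist Z x' y'"
      using mdist_triangle[OF m(1,2,3)] mdist_triangle[OF m(2,4,3)] mdist_commute[of Z x' y'] by simp
    moreover have "mdist Z y y' \<le> mdist Z x y + mdist Z x x' + mdist Z x' y'"
      using mdist_triangle[OF m(2,1,4)] mdist_triangle[OF m(1,3,4)] mdist_commute[of Z x y] by simp
    ultimately show ?case using xy xy' s(2) df dg by simp
  qed
  ultimately show "\<exists>R. correspondence X Y R \<and> distortion_less X Y R (2 * r)" by blast
next
  assume "\<exists>R. correspondence X Y R \<and> distortion_less X Y R (2 * r)"
  then obtain R where R: "correspondence X Y R" "distortion_less X Y R (2 * r)" by blast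
  have Rsub: "R \<subseteq> mspace X \<times> mspace Y" using R unfolding correspondence_def by force
  have finR: "finite R" using Rsub fin by (meson finite_SigmaI finite_subset)
  have neR: "R \<noteq> {}" using R ne unfolding correspondence_def by auto
  define D where "D = (\<lambda>(p, q). \<bar>mdist X (fst p) (fst q) - mdist Y (snd p) (snd q)\<bar>)"
  define T where "T = D ` (R \<times> R)"
  have T: "finite T" "T \<noteq> {}" unfolding T_def using finR neR by auto
  have "t < 2 * r" if "t \<in> T" for t
    using that R(2) unfolding distortion_less_def T_def D_def by fastforce
  then have Mr: "Max T < 2 * r" using T by simp
  have "t \<ge> 0" if "t \<in> T" for t using that unfolding T_def D_def by auto
  then have M0: "0 \<le> Max T" using T by simp
  \<comment> \<open>The midpoint of \<open>Max T / 2\<close> and \<open>r\<close>. Gluing bounds the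
    Hausdorff distance only non-strictly by \<open>c\<close>, so \<open>c\<close> must lie below
    \<open>r\<close> and still exceed half the distortion.\<close>
  define c where "c = (Max T / 2 + r) / 2"
  have c: "0 < c" "Max T < 2 * c" "c < r" using Mr M0 by (auto simp: c_def)
  have "D (p, q) < 2 * c" if "p \<in> R" "q \<in> R" for p q
  proof -
    have "D (p, q) \<in> T" unfolding T_def using that by blast
    then have "D (p, q) \<le> Max T" using T(1) by (rule Max_ge[rotated])
    with c(2) show ?thesis by simp
  qed
  then have "distortion_less X Y R (2 * c)"
    unfolding distortion_less_def D_def by fastforce
  from glued_realization[OF fin ne(1) R(1) c(1) this]
  obtain Z X' Y' where Z: "(Z, X', Y') \<in> realizations X Y" "hausdorff_dist Z X' Y' \<le> c" by blast
  have "bdd_below ((\<lambda>(Z, X', Y'). hausdorff_dist Z X' Y') ` realizations X Y)"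
  proof (rule bdd_belowI2[of _ 0], clarify)
    fix Z X' Y' assume "(Z, X', Y') \<in> realizations X Y"
    then show "0 \<le> hausdorff_dist Z X' Y'"
      using isometric_submetric_finite[of Z X' X] isometric_submetric_finite[of Z Y' Y] fin ne
      by (intro hausdorff_dist_nonneg) (auto simp: realizations_def)
  qed
  then have "gh_dist X Y \<le> hausdorff_dist Z X' Y'"
    unfolding gh_dist_eq by (rule cInf_lower[rotated]) (use Z(1) in force)
  then show "gh_dist X Y < r" using Z(2) c(3) by simp
qed

section \<open>Finite spaces with labelled points\<close>

definition index_space :: "nat \<Rightarrow> (nat \<Rightarrow> nat \<Rightarrow> real) \<Rightarrow> nat metric" where
  "index_space n D = metric ({..<n}, D)"

definition index_pairs :: "nat \<Rightarrow> (nat \<times> nat) set" where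
  "index_pairs n = {(i, j). i < j \<and> j < n}"

lemma index_space_simps [simp]:
  assumes "Metric_space {..<n} D"
  shows "mspace (index_space n D) = {..<n}" "mdist (index_space n D) = D"
  using assms unfolding index_space_def
  by (simp_all add: Metric_space.mspace_metric Metric_space.mdist_metric)

lemma finite_index_pairs: "finite (index_pairs n)"
  by (rule finite_subset[of _ "{..<n} \<times> {..<n}"]) (auto simp: index_pairs_def)

lemma card_index_pairs: "card (index_pairs n) = n * (n - 1) div 2"
proof -
  have "index_pairs n = prod.swap ` (SIGMA j:{..<n}. {..<j})"
    by (force simp: index_pairs_def image_iff)
  then have "card (index_pairs n) = card (SIGMA j:{..<n}. {..<j})"
    by (simp add: card_image)
  also have "\<dots> = (\<Sum>j<n. j)" by simp
  also have "\<dots> = n * (n - 1) div 2"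
  proof (induction n)
    case (Suc n)
    have "Suc n * (Suc n - 1) = 2 * n + n * (n - 1)" by (cases n) (auto simp: algebra_simps)
    with Suc show ?case by simp
  qed simp
  finally show ?thesis .
qed

lemma Metric_space_labelling:
  assumes e: "bij_betw e {..<n} (mspace W)"
  shows "Metric_space {..<n} (\<lambda>i j. mdist W (e i) (e j))"
    and "isometric (index_space n (\<lambda>i j. mdist W (e i) (e j))) W"
proof -
  show M: "Metric_space {..<n} (\<lambda>i j. mdist W (e i) (e j))"
  proof
    show "mdist W (e i) (e j) = 0 \<longleftrightarrow> i = j" if "i \<in> {..<n}" "j \<in> {..<n}" for i j
      using that e bij_betw_apply[OF e] by (auto simp: bij_betw_def inj_on_def)
    show "mdist W (e i) (e k) \<le> mdist W (e i) (e j) + mdist W (e j) (e k)"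
      if "i \<in> {..<n}" "j \<in> {..<n}" "k \<in> {..<n}" for i j k
      using that bij_betw_apply[OF e] by (intro mdist_triangle)
  qed (simp_all add: mdist_commute)
  show "isometric (index_space n (\<lambda>i j. mdist W (e i) (e j))) W"
    unfolding isometric_def by (rule exI[of _ e]) (simp add: M e)
qed

lemma isometry_class_self: "(W :: real metric) \<in> isometry_class W"
  by (simp add: isometry_class_def isometric_refl)

text \<open>Isometry classes contain only spaces with real labels, so an index space is replaced by
  a copy. The embedding \<open>real\<close> keeps the order of labels, by which
  \<open>half_distances\<close> selects each pair once.\<close>

lemma index_space_real_labels:
  assumes D: "Metric_space {..<n} D"
  obtains W :: "real metric" where "isometric (index_space n D) W"
    "mspace W = real ` {..<n}" "\<And>i j. mdist W (real i) (real j) = D i j"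
proof -
  interpret D: Metric_space "{..<n}" D by fact
  \<comment> \<open>The map \<open>nat \<lfloor>x\<rfloor>\<close> recovers the index from its
    label.\<close>
  have "Metric_space (real ` {..<n}) (\<lambda>x y. D (nat \<lfloor>x\<rfloor>) (nat \<lfloor>y\<rfloor>))"
    by unfold_locales (auto simp: D.commute D.triangle)
  then obtain W where W: "mspace W = real ` {..<n}" "mdist W = (\<lambda>x y. D (nat \<lfloor>x\<rfloor>) (nat \<lfloor>y\<rfloor>))"
    using Metric_space.mspace_metric Metric_space.mdist_metric by blast
  have "isometric (index_space n D) W"
    unfolding isometric_def by (rule exI[of _ real]) (auto simp: D W bij_betw_def)
  then show thesis by (rule that) (simp_all add: W)
qed

lemma ex_real_metric_isometric:
  assumes "Metric_space {..<n} D"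
  shows "\<exists>W :: real metric. isometric (index_space n D) W"
  by (rule index_space_real_labels[OF assms]) (rule exI)

lemma isometric_index_spaceE:
  assumes "Metric_space {..<n} D" "isometric (index_space n D) W"
  obtains e where "bij_betw e {..<n} (mspace W)"
    "\<And>i j. i < n \<Longrightarrow> j < n \<Longrightarrow> mdist W (e i) (e j) = D i j"
  using assms(2) unfolding isometric_def index_space_simps[OF assms(1)] Ball_def lessThan_iff
  by blast

text \<open>A multiset of reals has only one ascending arrangement, so any enumeration of the pairs
  along which \<open>D\<close> is ascending computes \<open>nu\<close>.\<close>

lemma nu_index_space:
  assumes D: "Metric_space {..<n} D"
    and ps: "distinct ps" "set ps = index_pairs n" "sorted (map (\<lambda>(i, j). D i j) ps)"
  shows "nu (isometry_class (index_space n D)) = map (\<lambda>(i, j). D i j / 2) ps"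
proof -
  obtain W :: "real metric" where W: "isometric (index_space n D) W"
    "mspace W = real ` {..<n}" "\<And>i j. mdist W (real i) (real j) = D i j"
    using index_space_real_labels[OF D] by blast
  let ?h = "map_prod real real"
  have "{(a, b). a \<in> mspace W \<and> b \<in> mspace W \<and> a < b} = ?h ` index_pairs n"
    by (force simp: W index_pairs_def image_iff)
  moreover have "inj_on ?h (index_pairs n)" by (auto simp: inj_on_def)
  ultimately have "image_mset (\<lambda>(a, b). mdist W a b)
        (mset_set {(a, b). a \<in> mspace W \<and> b \<in> mspace W \<and> a < b})
      = image_mset (\<lambda>(a, b). mdist W a b) (image_mset ?h (mset_set (index_pairs n)))"
    by (simp add: image_mset_mset_set)
  also have "\<dots> = image_mset (\<lambda>(i, j). D i j) (mset_set (index_pairs n))"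
    unfolding multiset.map_comp by (intro image_mset_cong) (auto simp: W)
  also have "\<dots> = mset (map (\<lambda>(i, j). D i j) ps)"
    using mset_set_set[OF ps(1)] ps(2) by simp
  finally have "half_distances W = map (\<lambda>t. t / 2) (map (\<lambda>(i, j). D i j) ps)"
    unfolding half_distances_def using ps(3) by (simp add: sorted_sort_id del: mset_map)
  moreover have "nu (isometry_class W) = half_distances W"
    by (rule nu_isometry_class) (simp add: W)
  ultimately show ?thesis
    unfolding isometry_class_eq[OF W(1)] by (simp add: case_prod_unfold o_def)
qed

section \<open>Maximum distance of vectors and matchings of families of reals\<close>

lemma max_dist_less_iff:
  assumes "length v = length w" "v \<noteq> []"
  shows "max_dist v w < r \<longleftrightarrow> (\<forall>i<length v. \<bar>v ! i - w ! i\<bar> < r)"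
proof -
  have "{\<bar>map2 (-) v w ! i\<bar> | i. i < length (map2 (-) v w)} =
      (\<lambda>i. \<bar>map2 (-) v w ! i\<bar>) ` {..<length v}"
    using assms(1) by (simp add: setcompr_eq_image lessThan_def)
  also have "\<dots> = (\<lambda>i. \<bar>v ! i - w ! i\<bar>) ` {..<length v}"
    using assms(1) by (intro image_cong) auto
  finally show ?thesis
    unfolding max_dist_def max_norm_def using assms(2) by (auto simp: lessThan_empty_iff)
qed

text \<open>On the line, matching two families in increasing order minimizes the largest displacement:
  among the points not above \<open>f p\<close>, some image under \<open>s\<close> is not below \<open>g p\<close>.\<close>

lemma monotone_matching_upper:
  fixes f g :: "'a \<Rightarrow> real"
  assumes fin: "finite P" and s: "bij_betw s P P"
    and mono: "\<And>p q. p \<in> P \<Longrightarrow> q \<in> P \<Longrightarrow> f p \<le> f q \<Longrightarrow> g p \<le> g q"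
    and close: "\<And>p. p \<in> P \<Longrightarrow> \<bar>f p - g (s p)\<bar> < c" and p: "p \<in> P"
  shows "g p < f p + c"
proof -
  \<comment> \<open>\<open>?L\<close> contains \<open>p\<close> and is strictly larger than
    \<open>?L'\<close>, so the injective \<open>s\<close> cannot map all of \<open>?L\<close> into
    \<open>?L'\<close>.\<close>
  let ?L = "{q \<in> P. f q \<le> f p}" and ?L' = "{q \<in> P. f q < f p}"
  have "?L' \<subset> ?L" using p by auto
  then have "card ?L' < card ?L" using fin by (intro psubset_card_mono) auto
  moreover have "inj_on s ?L" using s by (auto simp: bij_betw_def inj_on_def)
  then have "card (s ` ?L) = card ?L" by (rule card_image)
  ultimately have "\<not> s ` ?L \<subseteq> ?L'"
    using fin card_mono[of ?L' "s ` ?L"] by auto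
  then obtain q where q: "q \<in> P" "f q \<le> f p" "\<not> f (s q) < f p"
    using bij_betw_apply[OF s] by blast
  then have "g p \<le> g (s q)" using p bij_betw_apply[OF s] by (intro mono) auto
  with close[OF q(1)] q(2) show ?thesis by linarith
qed

text \<open>The missing lower bound is the upper bound for the negated families, since negation
  reverses the order of both.\<close>

lemma monotone_matching:
  fixes f g :: "'a \<Rightarrow> real"
  assumes fin: "finite P" and s: "bij_betw s P P"
    and mono: "\<And>p q. p \<in> P \<Longrightarrow> q \<in> P \<Longrightarrow> f p \<le> f q \<Longrightarrow> g p \<le> g q"
    and close: "\<And>p. p \<in> P \<Longrightarrow> \<bar>f p - g (s p)\<bar> < c" and p: "p \<in> P"
  shows "\<bar>f p - g p\<bar> < c"
proof -
  have "g p < f p + c" by (rule monotone_matching_upper[where f = f and g = g, OF assms])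
  moreover have "- g p < - f p + c"
    by (rule monotone_matching_upper[OF fin s _ _ p, of "\<lambda>p. - f p" "\<lambda>p. - g p"])
      (use mono close in \<open>force simp: abs_minus_commute\<close>)+
  ultimately show ?thesis by linarith
qed

text \<open>The correspondence criterion applies to the real copy \<open>Y\<close>. Relabelling
  along the isometry \<open>e\<close> and its inverse carries correspondences over to indices
  without changing the distortion.\<close>

lemma d_GH_index_space_less_iff:
  fixes Y W :: "real metric"
  assumes D: "Metric_space {..<n} D" and n: "n > 0"
    and Y: "isometric (index_space n D) Y" and fin: "finite (mspace W)" "mspace W \<noteq> {}"
  shows "d_GH (isometry_class (index_space n D)) (isometry_class W) < r \<longleftrightarrow>
    (\<exists>R. fst ` R = {..<n} \<and> snd ` R = mspace W \<and>
      (\<forall>(i, w)\<in>R. \<forall>(i', w')\<in>R. \<bar>D i i' - mdist W w w'\<bar> < 2 * r))"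
proof -
  obtain e where e: "bij_betw e {..<n} (mspace Y)"
    and de: "\<And>i j. i < n \<Longrightarrow> j < n \<Longrightarrow> mdist Y (e i) (e j) = D i j"
    using isometric_index_spaceE[OF D Y] by blast
  have fY: "finite (mspace Y)" "mspace Y \<noteq> {}"
    using e n bij_betw_finite[OF e] by (auto simp: bij_betw_def)
  define e' where "e' = inv_into {..<n} e"
  have e': "bij_betw e' (mspace Y) {..<n}" unfolding e'_def by (rule bij_betw_inv_into[OF e])
  have de': "D (e' x) (e' y) = mdist Y x y" if "x \<in> mspace Y" "y \<in> mspace Y" for x y
    using de[of "e' x" "e' y"] that bij_betw_apply[OF e'] bij_betw_inv_into_right[OF e]
    by (simp add: e'_def)
  have "d_GH (isometry_class (index_space n D)) (isometry_class W) = gh_dist Y W"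
    unfolding isometry_class_eq[OF Y] by (rule d_GH_isometry_class)
  also have "gh_dist Y W < r \<longleftrightarrow> (\<exists>R. correspondence Y W R \<and> distortion_less Y W R (2 * r))"
    by (rule gh_dist_less_iff[OF fY(1) fin(1) fY(2) fin(2)])
  also have "\<dots> \<longleftrightarrow> (\<exists>R. fst ` R = {..<n} \<and> snd ` R = mspace W \<and>
      (\<forall>(i, w)\<in>R. \<forall>(i', w')\<in>R. \<bar>D i i' - mdist W w w'\<bar> < 2 * r))" (is "?A \<longleftrightarrow> ?B")
  proof
    assume ?A
    then obtain R where R: "fst ` R = mspace Y" "snd ` R = mspace W" "distortion_less Y W R (2 * r)"
      unfolding correspondence_def by blast
    have m: "x \<in> mspace Y" if "(x, y) \<in> R" for x y using that R(1) by force
    have "fst ` map_prod e' id ` R = e' ` fst ` R" "snd ` map_prod e' id ` R = snd ` R"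
      by (auto simp: image_image)
    then have "fst ` map_prod e' id ` R = {..<n}" "snd ` map_prod e' id ` R = mspace W"
      using R e' by (auto simp: bij_betw_def)
    moreover have "\<forall>(i, w)\<in>map_prod e' id ` R. \<forall>(i', w')\<in>map_prod e' id ` R.
        \<bar>D i i' - mdist W w w'\<bar> < 2 * r"
    proof (clarsimp, goal_cases)
      case (1 x w x' w')
      then have "\<bar>mdist Y x x' - mdist W w w'\<bar> < 2 * r"
        using R(3) unfolding distortion_less_def by blast
      then show ?case using de'[OF m[OF 1(1)] m[OF 1(2)]] by simp
    qed
    ultimately show ?B by blast
  next
    assume ?B
    then obtain R where R: "fst ` R = {..<n}" "snd ` R = mspace W"
      "\<forall>(i, w)\<in>R. \<forall>(i', w')\<in>R. \<bar>D i i' - mdist W w w'\<bar> < 2 * r" by blast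
    have m: "x < n" if "(x, y) \<in> R" for x y using that R(1) by force
    have "fst ` map_prod e id ` R = e ` fst ` R" "snd ` map_prod e id ` R = snd ` R"
      by (auto simp: image_image)
    then have "correspondence Y W (map_prod e id ` R)"
      unfolding correspondence_def using R e by (auto simp: bij_betw_def)
    moreover have "distortion_less Y W (map_prod e id ` R) (2 * r)"
      unfolding distortion_less_def
    proof (clarsimp, goal_cases)
      case (1 i w i' w')
      then have "\<bar>D i i' - mdist W w w'\<bar> < 2 * r" using R(3) by blast
      then show ?case using de[OF m[OF 1(1)] m[OF 1(2)]] by simp
    qed
    ultimately show ?A by blast
  qed
  finally show ?thesis .
qed

section \<open>Perturbations of a space with well separated distances\<close>

text \<open>This is \<open>X\<close> with its points labelled by indices: \<open>far\<close>,
  \<open>gap\<close> and \<open>slack\<close> are the lower bounds that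
  \<open>delta X = 6 * \<delta>\<close> provides, and \<open>ps\<close> fixes the order in which
  \<open>nu\<close> lists the pairs of \<open>X\<close>.\<close>

locale separated_index_space =
  fixes n :: nat and D0 :: "nat \<Rightarrow> nat \<Rightarrow> real" and \<delta> :: real and ps :: "(nat \<times> nat) list"
  assumes n: "n \<ge> 2" and pos: "\<delta> > 0" and metric: "Metric_space {..<n} D0"
    and far: "\<lbrakk>i < n; j < n; i \<noteq> j\<rbrakk> \<Longrightarrow> 6 * \<delta> \<le> D0 i j"
    and gap: "\<lbrakk>i < n; j < n; p < n; q < n; i \<noteq> j; p \<noteq> q; {i, j} \<noteq> {p, q}\<rbrakk>
      \<Longrightarrow> 6 * \<delta> \<le> \<bar>D0 i j - D0 p q\<bar>"
    and slack: "\<lbrakk>i < n; j < n; k < n; i \<noteq> j; j \<noteq> k; i \<noteq> k\<rbrakk>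
      \<Longrightarrow> 6 * \<delta> \<le> D0 i j + D0 j k - D0 i k"
    and ps: "distinct ps" "set ps = index_pairs n" "sorted (map (\<lambda>(i, j). D0 i j) ps)"
begin

abbreviation cls :: "(nat \<Rightarrow> nat \<Rightarrow> real) \<Rightarrow> real metric set" where
  "cls D \<equiv> isometry_class (index_space n D)"

text \<open>The bound is \<open>2 * \<delta>\<close> because \<open>nu\<close> halves distances and
  a distortion is compared with twice the Gromov-Hausdorff distance; both balls of radius \<delta>
  thus turn into this one condition.\<close>

definition near :: "(nat \<Rightarrow> nat \<Rightarrow> real) \<Rightarrow> bool" where
  "near D \<longleftrightarrow> Metric_space {..<n} D \<and> (\<forall>i<n. \<forall>j<n. \<bar>D i j - D0 i j\<bar> < 2 * \<delta>)"

lemma near_D0: "near D0"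
  using metric pos by (simp add: near_def)

lemma nearD:
  assumes "near D" "i < n" "j < n" shows "\<bar>D i j - D0 i j\<bar> < 2 * \<delta>"
  using assms by (simp add: near_def)

lemma near_far:
  assumes "near D" "i < n" "j < n" "i \<noteq> j" shows "4 * \<delta> < D i j"
  using nearD[OF assms(1-3)] far[OF assms(2-4)] by linarith

lemma near_sym:
  assumes "near D" shows "D i j = D j i"
  using assms unfolding near_def by (meson Metric_space.commute)

lemma near_diag:
  assumes "near D" "i < n" shows "D i i = 0"
  using assms unfolding near_def by (meson Metric_space.mdist_zero lessThan_iff)

text \<open>Two entries approach each other by less than \<open>4 * \<delta>\<close>, which cannot
  close a gap of \<open>6 * \<delta>\<close>. Hence every perturbation orders the pairs as
  \<open>D0\<close> does.\<close>

lemma near_monotone: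
  assumes "near D" "near D'" and ij: "i < n" "j < n" "i \<noteq> j" and pq: "p < n" "q < n" "p \<noteq> q"
    and le: "D i j \<le> D p q"
  shows "D' i j \<le> D' p q"
proof (cases "{i, j} = {p, q}")
  case True
  then show ?thesis using near_sym[OF assms(2), of i j] by (auto simp: doubleton_eq_iff)
next
  case False
  then have "6 * \<delta> \<le> \<bar>D0 i j - D0 p q\<bar>" using ij pq by (intro gap)
  then show ?thesis
    using nearD[OF assms(1), of i j] nearD[OF assms(1), of p q]
      nearD[OF assms(2), of i j] nearD[OF assms(2), of p q] ij pq le by linarith
qed

section \<open>Distances between perturbations and between their vectors\<close>

lemma ps_nonempty: "ps \<noteq> []"
proof -
  have "(0, 1) \<in> set ps" using n ps(2) by (auto simp: index_pairs_def)
  then show ?thesis by auto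
qed

text \<open>The list \<open>ps\<close>, ascending for \<open>D0\<close>, stays ascending for
  \<open>D\<close> by \<open>near_monotone\<close>. Vectors of different perturbations can therefore
  be compared pair by pair.\<close>

lemma nu_near:
  assumes "near D" shows "nu (cls D) = map (\<lambda>(i, j). D i j / 2) ps"
proof (rule nu_index_space[OF _ ps(1,2)])
  show "Metric_space {..<n} D" using assms by (simp add: near_def)
  have "sorted_wrt (\<lambda>p q. (case p of (i, j) \<Rightarrow> D0 i j) \<le> (case q of (i, j) \<Rightarrow> D0 i j)) ps"
    using ps(3) by (simp add: sorted_wrt_map)
  then have "sorted_wrt (\<lambda>p q. (case p of (i, j) \<Rightarrow> D i j) \<le> (case q of (i, j) \<Rightarrow> D i j)) ps"
  proof (rule sorted_wrt_mono_rel[rotated], clarsimp, goal_cases)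
    case (1 i j p q)
    then show ?case using ps(2)
      by (intro near_monotone[OF near_D0 assms]) (auto simp: index_pairs_def)
  qed
  then show "sorted (map (\<lambda>(i, j). D i j) ps)" by (simp add: sorted_wrt_map)
qed

lemma max_dist_map_less_iff:
  "max_dist (map f ps) (map g ps) < r \<longleftrightarrow> (\<forall>p\<in>set ps. \<bar>f p - g p\<bar> < r)"
  using ps_nonempty by (simp add: max_dist_less_iff all_set_conv_all_nth)

lemma max_dist_near_less_iff:
  assumes "near D" "near D'"
  shows "max_dist (nu (cls D)) (nu (cls D')) < r \<longleftrightarrow> (\<forall>i<n. \<forall>j<n. \<bar>D i j - D' i j\<bar> < 2 * r)"
proof -
  have "max_dist (nu (cls D)) (nu (cls D')) < r \<longleftrightarrow>
      (\<forall>(i, j)\<in>index_pairs n. \<bar>D i j / 2 - D' i j / 2\<bar> < r)"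
    unfolding nu_near[OF assms(1)] nu_near[OF assms(2)] max_dist_map_less_iff ps(2)
    by (simp add: case_prod_unfold)
  also have "\<dots> \<longleftrightarrow> (\<forall>i j. i < j \<and> j < n \<longrightarrow> \<bar>D i j - D' i j\<bar> < 2 * r)"
  proof -
    have "\<bar>D i j / 2 - D' i j / 2\<bar> < r \<longleftrightarrow> \<bar>D i j - D' i j\<bar> < 2 * r" for i j by linarith
    then show ?thesis by (simp add: index_pairs_def)
  qed
  also have "\<dots> \<longleftrightarrow> (\<forall>i<n. \<forall>j<n. \<bar>D i j - D' i j\<bar> < 2 * r)"
  proof safe
    fix i j assume *: "\<forall>i j. i < j \<and> j < n \<longrightarrow> \<bar>D i j - D' i j\<bar> < 2 * r" and ij: "i < n" "j < n"
    \<comment> \<open>This pair exists because \<open>n\<close> is at least 2; it yields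
      \<open>0 < 2 * r\<close>, which settles the diagonal entries.\<close>
    have "\<bar>D 0 1 - D' 0 1\<bar> < 2 * r" using * n by simp
    then show "\<bar>D i j - D' i j\<bar> < 2 * r"
      using *[rule_format, of i j] *[rule_format, of j i] ij
        near_sym[OF assms(1), of i j] near_sym[OF assms(2), of i j]
        near_diag[OF assms(1), of i] near_diag[OF assms(2), of i]
      by (cases i j rule: linorder_cases) auto
  qed auto
  finally show ?thesis .
qed

text \<open>Matching equal indices gives one direction. Conversely, a correspondence of distortion
  below \<open>4 * \<delta>\<close> contains a permutation of the indices, and since both matrices
  order the pairs alike, \<open>monotone_matching\<close> shows that the identity does as well as
  this permutation.\<close>

lemma d_GH_near_less_iff:
  assumes D: "near D" "near D'" and r: "r \<le> 2 * \<delta>"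
  shows "d_GH (cls D) (cls D') < r \<longleftrightarrow> (\<forall>i<n. \<forall>j<n. \<bar>D i j - D' i j\<bar> < 2 * r)"
proof -
  have M: "Metric_space {..<n} D" "Metric_space {..<n} D'" using D by (auto simp: near_def)
  obtain Y :: "real metric" where Y: "isometric (index_space n D) Y"
    using ex_real_metric_isometric[OF M(1)] by blast
  obtain W :: "real metric" where W: "isometric (index_space n D') W"
    using ex_real_metric_isometric[OF M(2)] by blast
  obtain e where e: "bij_betw e {..<n} (mspace W)"
    and de: "\<And>i j. i < n \<Longrightarrow> j < n \<Longrightarrow> mdist W (e i) (e j) = D' i j"
    using isometric_index_spaceE[OF M(2) W] by blast
  have fW: "finite (mspace W)" "mspace W \<noteq> {}"
    using e n bij_betw_finite[OF e] by (auto simp: bij_betw_def lessThan_empty_iff)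
  have n0: "n > 0" using n by simp
  show ?thesis
    unfolding isometry_class_eq[OF W] d_GH_index_space_less_iff[OF M(1) n0 Y fW]
  proof (rule iffI; (elim exE conjE)?; (intro allI impI)?)
    fix R i0 j0
    assume R: "fst ` R = {..<n}" "snd ` R = mspace W"
      "\<forall>(i, w)\<in>R. \<forall>(i', w')\<in>R. \<bar>D i i' - mdist W w w'\<bar> < 2 * r"
      and ij: "i0 < n" "j0 < n"
    have "\<exists>k<n. (i, e k) \<in> R" if "i < n" for i
    proof -
      have "i \<in> fst ` R" using that R(1) by simp
      then obtain w where w: "(i, w) \<in> R" by auto
      then have "w \<in> e ` {..<n}" using R(2) e by (force simp: bij_betw_def)
      with w show ?thesis by auto
    qed
    then obtain s where s: "\<And>i. i < n \<Longrightarrow> s i < n \<and> (i, e (s i)) \<in> R" by metis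
    have dist: "\<bar>D i j - D' (s i) (s j)\<bar> < 2 * r" if "i < n" "j < n" for i j
      using R(3) s[OF that(1)] s[OF that(2)] de[of "s i" "s j"] by fastforce
    \<comment> \<open>Identifying two indices would force \<open>D i j < 2 * r\<close>, while
      \<open>near_far\<close> gives \<open>4 * \<delta> < D i j\<close>; here
      \<open>r \<le> 2 * \<delta>\<close> enters.\<close>
    have inj: "inj_on s {..<n}"
    proof (rule inj_onI, rule ccontr)
      fix i j assume *: "i \<in> {..<n}" "j \<in> {..<n}" "s i = s j" "i \<noteq> j"
      then show False
        using dist[of i j] near_far[OF D(1), of i j] near_diag[OF D(2), of "s j"] s[of j] r
        by auto
    qed
    then have sb: "s ` {..<n} = {..<n}" using s by (intro endo_inj_surj) auto
    \<comment> \<open>The permutation \<open>s\<close> acts on ordered pairs of distinct indices.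
      The diagonal is left out because \<open>near_monotone\<close> compares only distances between
      distinct points.\<close>
    let ?P = "{(i, j). i < n \<and> j < n \<and> i \<noteq> j}"
    have "inj_on (map_prod s s) ?P" using inj by (auto simp: inj_on_def)
    moreover have finP: "finite ?P" by (rule finite_subset[of _ "{..<n} \<times> {..<n}"]) auto
    moreover have "map_prod s s ` ?P \<subseteq> ?P" using s inj by (auto simp: inj_on_def)
    ultimately have bij: "bij_betw (map_prod s s) ?P ?P"
      by (simp add: bij_betw_def endo_inj_surj)
    show "\<bar>D i0 j0 - D' i0 j0\<bar> < 2 * r"
    proof (cases "i0 = j0")
      case True
      then show ?thesis
        using dist[of i0 i0] ij near_diag[OF D(1)] near_diag[OF D(2)] s[of i0] by simp
    next
      case False
      have "\<bar>(\<lambda>(i, j). D i j) (i0, j0) - (\<lambda>(i, j). D' i j) (i0, j0)\<bar> < 2 * r"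
      proof (rule monotone_matching[OF finP bij])
        show "(case p of (i, j) \<Rightarrow> D' i j) \<le> (case q of (i, j) \<Rightarrow> D' i j)"
          if "p \<in> ?P" "q \<in> ?P" "(case p of (i, j) \<Rightarrow> D i j) \<le> (case q of (i, j) \<Rightarrow> D i j)" for p q
          using that near_monotone[OF D] by (cases p; cases q) auto
        show "\<bar>(case p of (i, j) \<Rightarrow> D i j) - (case map_prod s s p of (i, j) \<Rightarrow> D' i j)\<bar> < 2 * r"
          if "p \<in> ?P" for p
          using that dist by (cases p) auto
        show "(i0, j0) \<in> ?P" using False ij by simp
      qed
      then show ?thesis by simp
    qed
  next
    assume *: "\<forall>i<n. \<forall>j<n. \<bar>D i j - D' i j\<bar> < 2 * r"
    let ?R = "(\<lambda>i. (i, e i)) ` {..<n}"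
    have "snd ` ?R = mspace W" "fst ` ?R = {..<n}"
      using e by (auto simp: image_image bij_betw_def)
    moreover have "\<forall>(i, w)\<in>?R. \<forall>(i', w')\<in>?R. \<bar>D i i' - mdist W w w'\<bar> < 2 * r"
      using * de by auto
    ultimately show "\<exists>R. fst ` R = {..<n} \<and> snd ` R = mspace W \<and>
        (\<forall>(i, w)\<in>R. \<forall>(i', w')\<in>R. \<bar>D i i' - mdist W w w'\<bar> < 2 * r)" by blast
  qed
qed

text \<open>Both numbers lie below \<open>2 * \<delta>\<close> and have the same strict upper bounds
  up to that threshold. Taking each of them as the bound for the other gives equality.\<close>

lemma max_dist_eq_d_GH:
  assumes "near D" "near D'"
  shows "max_dist (nu (cls D)) (nu (cls D')) = d_GH (cls D) (cls D')"
proof -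
  let ?m = "max_dist (nu (cls D)) (nu (cls D'))" and ?d = "d_GH (cls D) (cls D')"
  have iff: "?d < r \<longleftrightarrow> ?m < r" if "r \<le> 2 * \<delta>" for r
    unfolding d_GH_near_less_iff[OF assms that] max_dist_near_less_iff[OF assms] ..
  have "\<bar>D i j - D' i j\<bar> < 2 * (2 * \<delta>)" if "i < n" "j < n" for i j
    using nearD[OF assms(1) that] nearD[OF assms(2) that] by linarith
  then have "?m < 2 * \<delta>" unfolding max_dist_near_less_iff[OF assms] by blast
  moreover from this have "?d < 2 * \<delta>" by (simp add: iff)
  ultimately show ?thesis using iff[of ?m] iff[of ?d] by linarith
qed

section \<open>The two balls described by perturbations\<close>

lemma cls_GH_exactly:
  assumes "near D" shows "cls D \<in> GH_exactly n"
proof -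
  have M: "Metric_space {..<n} D" using assms by (simp add: near_def)
  have "{..<n} \<noteq> {}" using n by (auto simp: lessThan_empty_iff)
  then show ?thesis using finite_isometry_class[of "index_space n D"] M by simp
qed

lemma d_GH_near:
  assumes "near D" shows "d_GH (cls D0) (cls D) < \<delta>"
  using assms pos d_GH_near_less_iff[OF near_D0 assms, of \<delta>] nearD[OF assms]
  by (simp add: abs_minus_commute)

text \<open>A correspondence of distortion below \<open>2 * \<delta>\<close> picks a point for each
  index. Different indices get different points because distances in \<open>D0\<close> are at least
  \<open>6 * \<delta>\<close>, and having at most \<open>n\<close> points makes the choice
  surjective.\<close>

lemma ball_subset_near:
  assumes A: "A \<in> GH_atmost n" and d: "d_GH (cls D0) A < \<delta>"
  shows "\<exists>D. near D \<and> A = cls D"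
proof -
  obtain W :: "real metric" where W: "A = isometry_class W" "mspace W \<noteq> {}"
    using A unfolding GH_atmost_def GH_space_def mem_Collect_eq by blast
  have fW: "finite (mspace W)" "card (mspace W) \<le> n"
    using A isometry_class_self[of W] unfolding GH_atmost_def W(1) by auto
  obtain Y :: "real metric" where Y: "isometric (index_space n D0) Y"
    using ex_real_metric_isometric[OF metric] by blast
  have n0: "n > 0" using n by simp
  obtain R where R: "fst ` R = {..<n}" "snd ` R = mspace W"
    "\<forall>(i, w)\<in>R. \<forall>(i', w')\<in>R. \<bar>D0 i i' - mdist W w w'\<bar> < 2 * \<delta>"
    using d unfolding W(1) d_GH_index_space_less_iff[OF metric n0 Y fW(1) W(2)] by blast
  have "\<exists>w. (i, w) \<in> R" if "i < n" for i
  proof -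
    have "i \<in> fst ` R" using that R(1) by simp
    then show ?thesis by auto
  qed
  then obtain e where e: "\<And>i. i < n \<Longrightarrow> (i, e i) \<in> R" by metis
  have eW: "e ` {..<n} \<subseteq> mspace W" using e R(2) by force
  have dist: "\<bar>mdist W (e i) (e j) - D0 i j\<bar> < 2 * \<delta>" if "i < n" "j < n" for i j
    using R(3) e[OF that(1)] e[OF that(2)] by (fastforce simp: abs_minus_commute)
  have inj: "inj_on e {..<n}"
  proof (rule inj_onI, rule ccontr)
    fix i j assume *: "i \<in> {..<n}" "j \<in> {..<n}" "e i = e j" "i \<noteq> j"
    then have "mdist W (e i) (e j) = 0" using eW by auto
    then show False using dist[of i j] far[of i j] * pos by auto
  qed
  have "e ` {..<n} = mspace W"
    using eW fW inj by (intro card_seteq) (auto simp: card_image)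
  then have "bij_betw e {..<n} (mspace W)" using inj by (simp add: bij_betw_def)
  note L = Metric_space_labelling[OF this]
  show ?thesis
    using dist L(1) isometry_class_eq[OF L(2)] W(1)
    by (intro exI[of _ "\<lambda>i j. mdist W (e i) (e j)"]) (simp add: near_def)
qed

text \<open>Doubling the coordinates of \<open>v\<close> and placing them at the pairs in
  \<open>ps\<close> gives a symmetric matrix, which the separation bounds make a metric.\<close>

lemma vector_ball_subset_near:
  assumes len: "length v = length ps" and d: "max_dist v (nu (cls D0)) < \<delta>"
  shows "\<exists>D. near D \<and> nu (cls D) = v"
proof -
  \<comment> \<open>The lookup uses the pair with the smaller index first, as in \<open>ps\<close>,
    which makes \<open>D\<close> symmetric. The value 0 elsewhere supplies the diagonal and keeps
    \<open>D\<close> nonnegative for all arguments.\<close>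
  define D where "D i j = (if i < n \<and> j < n \<and> i \<noteq> j
    then 2 * the (map_of (zip ps v) (min i j, max i j)) else 0)" for i j
  have Dk: "D i j = 2 * v ! k" if "k < length ps" "ps ! k = (i, j)" for i j k
  proof -
    have "(i, j) \<in> index_pairs n" using that ps(2) nth_mem by metis
    then show ?thesis
      using that map_of_zip_nth[OF len[symmetric] ps(1), of k] len by (simp add: D_def index_pairs_def)
  qed
  have close: "\<bar>v ! k - (case ps ! k of (i, j) \<Rightarrow> D0 i j / 2)\<bar> < \<delta>" if "k < length ps" for k
    using d that len ps_nonempty unfolding nu_near[OF near_D0]
    by (subst (asm) max_dist_less_iff) auto
  have sym: "D i j = D j i" for i j by (simp add: D_def min.commute max.commute)
  have D0sym: "D0 i j = D0 j i" for i j by (rule near_sym[OF near_D0])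
  have lt: "\<bar>D i j - D0 i j\<bar> < 2 * \<delta>" if "i < j" "j < n" for i j
  proof -
    have "(i, j) \<in> set ps" using that ps(2) by (simp add: index_pairs_def)
    then obtain k where k: "k < length ps" "ps ! k = (i, j)" by (auto simp: in_set_conv_nth)
    show ?thesis using close[OF k(1)] Dk[OF k] k(2) by simp
  qed
  have D: "\<bar>D i j - D0 i j\<bar> < 2 * \<delta>" if "i < n" "j < n" for i j
    using lt[of i j] lt[of j i] that sym[of i j] D0sym[of i j] near_diag[OF near_D0, of i] pos
    by (cases i j rule: linorder_cases) (auto simp: D_def)
  have Dpos: "0 < D i j" if "i < n" "j < n" "i \<noteq> j" for i j
    using D[OF that(1,2)] far[OF that] pos by linarith
  have Ddiag: "D i i = 0" for i by (simp add: D_def)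
  have "Metric_space {..<n} D"
  proof
    show nonneg: "0 \<le> D i j" for i j
      using Dpos[of i j] by (cases "i < n \<and> j < n \<and> i \<noteq> j") (auto simp: D_def)
    show "D i j = D j i" for i j by (rule sym)
    show "D i j = 0 \<longleftrightarrow> i = j" if "i \<in> {..<n}" "j \<in> {..<n}" for i j
      using Dpos[of i j] that Ddiag by force
    show "D i k \<le> D i j + D j k" if "i \<in> {..<n}" "j \<in> {..<n}" "k \<in> {..<n}" for i j k
    proof (cases "i = j \<or> j = k \<or> i = k")
      case True
      then show ?thesis using Ddiag nonneg[of i j] nonneg[of j i] by auto
    next
      case False
      \<comment> \<open>Three entries move by less than \<open>2 * \<delta>\<close> each, which the
        slack \<open>6 * \<delta>\<close> absorbs.\<close>
      then show ?thesis
        using slack[of i j k] D[of i j] D[of j k] D[of i k] that by auto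
    qed
  qed
  with D have near: "near D" by (simp add: near_def)
  moreover have "nu (cls D) = v"
    unfolding nu_near[OF near] using Dk len
    by (intro nth_equalityI) (auto split: prod.split)
  ultimately show ?thesis by blast
qed

text \<open>Both vectors list their entries in the order of \<open>ps\<close>, so equal vectors mean
  equal matrices, and the identity on indices is an isometry.\<close>

lemma cls_eqI:
  assumes "near D" "near D'" "nu (cls D) = nu (cls D')" shows "cls D = cls D'"
proof (rule isometry_class_eq)
  have M: "Metric_space {..<n} D" "Metric_space {..<n} D'" using assms by (auto simp: near_def)
  have lt: "D i j = D' i j" if "i < j" "j < n" for i j
  proof -
    have "(i, j) \<in> set ps" using that ps(2) by (simp add: index_pairs_def)
    moreover have "\<forall>p\<in>set ps. (case p of (i, j) \<Rightarrow> D i j / 2) = (case p of (i, j) \<Rightarrow> D' i j / 2)"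
      using assms(3) unfolding nu_near[OF assms(1)] nu_near[OF assms(2)] by simp
    ultimately show ?thesis by fastforce
  qed
  have "D i j = D' i j" if "i < n" "j < n" for i j
    using lt[of i j] lt[of j i] that near_sym[OF assms(1), of i j] near_sym[OF assms(2), of i j]
      near_diag[OF assms(1), of i] near_diag[OF assms(2), of i]
    by (cases i j rule: linorder_cases) auto
  then show "isometric (index_space n D) (index_space n D')"
    unfolding isometric_def using M by (intro exI[of _ id]) auto
qed

end

section \<open>Lower bounds supplied by \<open>delta\<close> of a generic space\<close>

lemma mdist_self: "x \<in> mspace X \<Longrightarrow> mdist X x x = 0"
  by simp

lemma mdist_pos: "\<lbrakk>x \<in> mspace X; y \<in> mspace X; x \<noteq> y\<rbrakk> \<Longrightarrow> 0 < mdist X x y"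
  using mdist_nonneg[of X x y] mdist_zero[of x X y] by linarith

text \<open>With three or more points, both minima range over finite nonempty sets, whose members
  are positive by genericity. With two points, \<open>delta X\<close> is the only nonzero
  distance.\<close>

lemma delta_bounds:
  fixes X :: "'a metric"
  assumes g: "generic_space X" and c: "card (mspace X) \<ge> 2"
  shows "delta X > 0"
    and "\<lbrakk>x \<in> mspace X; y \<in> mspace X; x \<noteq> y\<rbrakk> \<Longrightarrow> delta X \<le> mdist X x y"
    and "\<lbrakk>x \<in> mspace X; y \<in> mspace X; p \<in> mspace X; q \<in> mspace X; x \<noteq> y; p \<noteq> q; {x, y} \<noteq> {p, q}\<rbrakk>
      \<Longrightarrow> delta X \<le> \<bar>mdist X x y - mdist X p q\<bar>"
    and "\<lbrakk>x \<in> mspace X; y \<in> mspace X; z \<in> mspace X; x \<noteq> y; y \<noteq> z; x \<noteq> z\<rbrakk>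
      \<Longrightarrow> delta X \<le> mdist X x y + mdist X y z - mdist X x z"
proof -
  have fin: "finite (mspace X)" using g by (simp add: generic_space_def)
  \<comment> \<open>The four claims form one conjunction so that the distinction by the number of
    points is made once.\<close>
  have "delta X > 0 \<and> (\<forall>x\<in>mspace X. \<forall>y\<in>mspace X. x \<noteq> y \<longrightarrow> delta X \<le> mdist X x y) \<and>
    (\<forall>x\<in>mspace X. \<forall>y\<in>mspace X. \<forall>p\<in>mspace X. \<forall>q\<in>mspace X.
       x \<noteq> y \<and> p \<noteq> q \<and> {x, y} \<noteq> {p, q} \<longrightarrow> delta X \<le> \<bar>mdist X x y - mdist X p q\<bar>) \<and>
    (\<forall>x\<in>mspace X. \<forall>y\<in>mspace X. \<forall>z\<in>mspace X. x \<noteq> y \<and> y \<noteq> z \<and> x \<noteq> z \<longrightarrow>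
       delta X \<le> mdist X x y + mdist X y z - mdist X x z)"
  proof (cases "card (mspace X) = 2")
    case True
    then obtain a b where ab: "mspace X = {a, b}" "a \<noteq> b" by (meson card_2_iff)
    have "delta X = (THE t. \<exists>x y. mspace X = {x, y} \<and> x \<noteq> y \<and> t = mdist X x y)"
      using True by (simp add: delta_def)
    also have "\<dots> = mdist X a b"
      by (rule the_equality) (use ab in \<open>auto simp: doubleton_eq_iff mdist_commute\<close>)
    finally have d: "delta X = mdist X a b" .
    have "0 < mdist X a b" using ab by (simp add: order_less_le)
    then show ?thesis using ab d by (auto simp: mdist_commute insert_commute)
  next
    case False
    define S where "S = {mdist X x y + mdist X y z - mdist X x z | x y z.
           x \<in> mspace X \<and> y \<in> mspace X \<and> z \<in> mspace X \<and> card {x, y, z} = 3}"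
    define T where "T = {\<bar>mdist X x y - mdist X p q\<bar> | x y p q.
           x \<in> mspace X \<and> y \<in> mspace X \<and> p \<in> mspace X \<and> q \<in> mspace X \<and>
           card {x, y, p, q} \<ge> 3}"
    have d: "delta X = min (Min S) (Min T)" using False by (simp add: delta_def S_def T_def)
    let ?M = "mspace X"
    have "S \<subseteq> (\<lambda>(x, y, z). mdist X x y + mdist X y z - mdist X x z) ` (?M \<times> ?M \<times> ?M)"
      unfolding S_def by force
    then have fS: "finite S" using fin by (meson finite_SigmaI finite_imageI finite_subset)
    have "T \<subseteq> (\<lambda>(x, y, p, q). \<bar>mdist X x y - mdist X p q\<bar>) ` (?M \<times> ?M \<times> ?M \<times> ?M)"
      unfolding T_def by force
    then have fT: "finite T" using fin by (meson finite_SigmaI finite_imageI finite_subset)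
    obtain K where "K \<subseteq> ?M" "card K = 3"
      using c False obtain_subset_with_card_n[of 3 ?M] by force
    then obtain a b c where abc: "a \<in> ?M" "b \<in> ?M" "c \<in> ?M" "a \<noteq> b" "b \<noteq> c" "a \<noteq> c"
      by (auto simp: card_3_iff)
    have SI: "mdist X x y + mdist X y z - mdist X x z \<in> S"
      if "x \<in> ?M" "y \<in> ?M" "z \<in> ?M" "x \<noteq> y" "y \<noteq> z" "x \<noteq> z" for x y z
      unfolding S_def using that by (auto simp: card_insert_if)
    have card3: "card {x, y, p, q} \<ge> 3" if "u \<in> {x, y, p, q}" "v \<in> {x, y, p, q}" "w \<in> {x, y, p, q}"
      "u \<noteq> v" "v \<noteq> w" "u \<noteq> w" for x y p q u v w :: 'a
      using card_mono[of "{x, y, p, q}" "{u, v, w}"] that by auto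
    have TI: "\<bar>mdist X x y - mdist X p q\<bar> \<in> T"
      if "x \<in> ?M" "y \<in> ?M" "p \<in> ?M" "q \<in> ?M" "card {x, y, p, q} \<ge> 3" for x y p q
      unfolding T_def using that by blast
    have "t > 0" if "t \<in> S" for t
    proof -
      from that obtain x y z where t: "t = mdist X x y + mdist X y z - mdist X x z"
        "x \<in> ?M" "y \<in> ?M" "z \<in> ?M" "card {x, y, z} = 3" unfolding S_def by blast
      have "x \<noteq> y \<and> y \<noteq> z \<and> x \<noteq> z" using t(5) by (auto simp: card_insert_if split: if_splits)
      then show ?thesis using g t unfolding generic_space_def by fastforce
    qed
    then have "Min S > 0" using fS SI[OF abc] by (subst Min_gr_iff) auto
    moreover have "t > 0" if "t \<in> T" for t
    proof -
      from that obtain x y p q where t: "t = \<bar>mdist X x y - mdist X p q\<bar>"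
        "x \<in> ?M" "y \<in> ?M" "p \<in> ?M" "q \<in> ?M" "card {x, y, p, q} \<ge> 3" unfolding T_def by blast
      \<comment> \<open>Three distinct points among the four rule out two degenerate pairs as well
        as two equal unordered pairs.\<close>
      consider "x = y" "p \<noteq> q" | "x \<noteq> y" "p = q" | "x \<noteq> y" "p \<noteq> q" "{x, y} \<noteq> {p, q}"
        using t(6) by (fastforce simp: card_insert_if doubleton_eq_iff split: if_splits)
      then show ?thesis
      proof cases
        case 1
        then show ?thesis using t mdist_pos[of p X q] mdist_self[of y X] by simp
      next
        case 2
        then show ?thesis using t mdist_pos[of x X y] mdist_self[of q X] by simp
      next
        case 3
        then have "mdist X x y \<noteq> mdist X p q" using g t unfolding generic_space_def by blast
        then show ?thesis using t(1) by simp
      qed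
    qed
    moreover have aabc: "\<bar>mdist X a b - mdist X c c\<bar> \<in> T"
      using abc by (intro TI card3[of a _ _ _ _ b c]) auto
    ultimately have "delta X > 0" using fT unfolding d by (subst min_less_iff_conj, subst Min_gr_iff) auto
    moreover have "delta X \<le> mdist X x y" if xy: "x \<in> ?M" "y \<in> ?M" "x \<noteq> y" for x y
    proof -
      \<comment> \<open>A third point gives a degenerate pair \<open>z\<close>, \<open>z\<close>,
        which puts the distance of \<open>x\<close> and \<open>y\<close> itself among the members of
        \<open>T\<close>.\<close>
      obtain z where z: "z \<in> ?M" "z \<noteq> x" "z \<noteq> y" using abc by metis
      have "\<bar>mdist X x y - mdist X z z\<bar> \<in> T"
        using xy z by (intro TI card3[of x _ _ _ _ y z]) auto
      then have "Min T \<le> \<bar>mdist X x y - mdist X z z\<bar>" using fT by (intro Min_le)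
      also have "\<bar>mdist X x y - mdist X z z\<bar> = mdist X x y" using z by (simp add: mdist_self)
      finally show ?thesis using d by simp
    qed
    moreover have "delta X \<le> \<bar>mdist X x y - mdist X p q\<bar>"
      if xy: "x \<in> ?M" "y \<in> ?M" "p \<in> ?M" "q \<in> ?M" "x \<noteq> y" "p \<noteq> q" "{x, y} \<noteq> {p, q}" for x y p q
    proof -
      \<comment> \<open>Different unordered pairs of distinct points involve at least three points,
        as the second minimum demands.\<close>
      have "p \<notin> {x, y} \<or> q \<notin> {x, y}" using xy by auto
      then have "card {x, y, p, q} \<ge> 3"
        using xy(5) card3[of x x y p q y p] card3[of x x y p q y q] by blast
      then have "Min T \<le> \<bar>mdist X x y - mdist X p q\<bar>" using fT TI xy by (intro Min_le) auto
      then show ?thesis using d by simp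
    qed
    moreover have "delta X \<le> mdist X x y + mdist X y z - mdist X x z"
      if "x \<in> ?M" "y \<in> ?M" "z \<in> ?M" "x \<noteq> y" "y \<noteq> z" "x \<noteq> z" for x y z
      using Min_le[OF fS SI[OF that]] d by simp
    ultimately show ?thesis by simp
  qed
  note * = this[THEN conjunct1] this[THEN conjunct2, THEN conjunct1]
    this[THEN conjunct2, THEN conjunct2, THEN conjunct1]
    this[THEN conjunct2, THEN conjunct2, THEN conjunct2]
  show "delta X > 0" by (rule *(1))
  show "delta X \<le> mdist X x y" if "x \<in> mspace X" "y \<in> mspace X" "x \<noteq> y"
    using *(2) that by simp
  show "delta X \<le> \<bar>mdist X x y - mdist X p q\<bar>" if "x \<in> mspace X" "y \<in> mspace X"
    "p \<in> mspace X" "q \<in> mspace X" "x \<noteq> y" "p \<noteq> q" "{x, y} \<noteq> {p, q}"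
    using *(3) that by simp
  show "delta X \<le> mdist X x y + mdist X y z - mdist X x z" if "x \<in> mspace X" "y \<in> mspace X"
    "z \<in> mspace X" "x \<noteq> y" "y \<noteq> z" "x \<noteq> z"
    using *(4) that by simp
qed

section \<open>The isometry between the two balls\<close>

theorem theorem4p1:
  fixes X :: "'a metric" and n N :: nat and \<delta> :: real
    and U :: "real metric set set" and V :: "real list set"
  assumes "n \<ge> 2"
    and "generic_space X" and "card (mspace X) = n"
    and "\<delta> = delta X / 6" and "N = n * (n - 1) div 2"
    and "U = {Y \<in> GH_atmost n. d_GH (isometry_class X) Y < \<delta>}"
    and "V = {v \<in> vec_space N. max_dist v (nu (isometry_class X)) < \<delta>}"
  shows "U \<subseteq> GH_exactly n \<and> bij_betw nu U V \<and>
    (\<forall>Y\<in>U. \<forall>Z\<in>U. max_dist (nu Y) (nu Z) = d_GH Y Z)"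
proof -
  have fin: "finite (mspace X)" using assms(2) by (simp add: generic_space_def)
  obtain e where e: "bij_betw e {..<n} (mspace X)"
    using ex_bij_betw_nat_finite[OF fin] assms(3) by (auto simp: lessThan_atLeast0)
  have em: "e i \<in> mspace X" if "i < n" for i using bij_betw_apply[OF e] that by simp
  have inj: "e i = e j \<longleftrightarrow> i = j" if "i < n" "j < n" for i j
    using e that by (auto simp: bij_betw_def inj_on_def)
  define D0 where "D0 i j = mdist X (e i) (e j)" for i j
  have L: "Metric_space {..<n} D0" "isometric (index_space n D0) X"
    using Metric_space_labelling[OF e] unfolding D0_def by auto
  have clsX: "isometry_class X = isometry_class (index_space n D0)"
    using isometry_class_eq[OF L(2)] by simp
  have c2: "card (mspace X) \<ge> 2" using assms by simp
  note db = delta_bounds[OF assms(2) c2]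
  have d6: "6 * \<delta> = delta X" using assms(4) by simp
  obtain qs where qs: "set qs = index_pairs n" "distinct qs"
    using finite_distinct_list[OF finite_index_pairs] by blast
  define ps where "ps = sort_key (\<lambda>(i, j). D0 i j) qs"
  interpret separated_index_space n D0 \<delta> ps
  proof (rule separated_index_space.intro)
    show "2 \<le> n" by fact
    show "0 < \<delta>" using db(1) assms(4) by simp
    show "Metric_space {..<n} D0" by (rule L)
    show "6 * \<delta> \<le> D0 i j" if "i < n" "j < n" "i \<noteq> j" for i j
      unfolding d6 D0_def using that em inj by (intro db(2)) auto
    show "6 * \<delta> \<le> \<bar>D0 i j - D0 p q\<bar>"
      if "i < n" "j < n" "p < n" "q < n" "i \<noteq> j" "p \<noteq> q" "{i, j} \<noteq> {p, q}" for i j p q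
      unfolding d6 D0_def using that em inj by (intro db(3)) (auto simp: doubleton_eq_iff)
    show "6 * \<delta> \<le> D0 i j + D0 j k - D0 i k"
      if "i < n" "j < n" "k < n" "i \<noteq> j" "j \<noteq> k" "i \<noteq> k" for i j k
      unfolding d6 D0_def using that em inj by (intro db(4)) auto
    show "distinct ps" "set ps = index_pairs n" using qs by (simp_all add: ps_def)
    show "sorted (map (\<lambda>(i, j). D0 i j) ps)" unfolding ps_def by (rule sorted_sort_key)
  qed
  have len: "length ps = N"
    using distinct_card[OF ps(1)] card_index_pairs[of n] ps(2) assms(5) by simp
  have sub: "GH_exactly n \<subseteq> GH_atmost n" by (auto simp: GH_exactly_def GH_atmost_def)
  \<comment> \<open>The ball \<open>U\<close> consists exactly of the classes of perturbations, so
    the statements about \<open>near\<close> matrices transfer to it.\<close>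
  have U: "U = cls ` Collect near"
  proof (intro equalityI subsetI)
    fix A assume "A \<in> U"
    then have "A \<in> GH_atmost n" "d_GH (cls D0) A < \<delta>" by (simp_all add: assms(6) clsX)
    then show "A \<in> cls ` Collect near" using ball_subset_near[of A] by auto
  next
    fix A assume "A \<in> cls ` Collect near"
    then obtain D where D: "near D" "A = cls D" by auto
    then show "A \<in> U"
      using cls_GH_exactly[OF D(1)] d_GH_near[OF D(1)] sub by (auto simp: assms(6) clsX)
  qed
  \<comment> \<open>Once \<open>V\<close> is the image of \<open>U\<close>, bijectivity is reduced
    to injectivity.\<close>
  have V: "V = nu ` U"
    unfolding U image_image
  proof (intro equalityI subsetI)
    fix v assume "v \<in> V"
    then have "length v = length ps" "max_dist v (nu (cls D0)) < \<delta>"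
      by (simp_all add: assms(7) clsX vec_space_def len)
    then obtain D where "near D" "nu (cls D) = v" using vector_ball_subset_near[of v] by auto
    then show "v \<in> (\<lambda>D. nu (cls D)) ` Collect near" by auto
  next
    fix v assume "v \<in> (\<lambda>D. nu (cls D)) ` Collect near"
    then obtain D where D: "near D" "v = nu (cls D)" by auto
    have "max_dist v (nu (cls D0)) < \<delta>"
      unfolding D(2) max_dist_near_less_iff[OF D(1) near_D0] using nearD[OF D(1)] by simp
    moreover have "length v = N" using nu_near[OF D(1)] len D(2) by simp
    ultimately show "v \<in> V" by (simp add: assms(7) clsX vec_space_def)
  qed
  have "U \<subseteq> GH_exactly n" unfolding U by (auto intro: cls_GH_exactly)
  moreover have "inj_on nu U"
    unfolding U by (rule inj_onI) (elim imageE CollectE; hypsubst; rule cls_eqI; assumption)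
  then have "bij_betw nu U V" unfolding V by (rule inj_on_imp_bij_betw)
  moreover have "\<forall>Y\<in>U. \<forall>Z\<in>U. max_dist (nu Y) (nu Z) = d_GH Y Z"
    unfolding U by (auto intro: max_dist_eq_d_GH)
  ultimately show ?thesis by (intro conjI)
qed

end
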